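(* Let $\Xi$ be finite, $\delta>0$, $r>0$, $z\in Z$, and let $\Xi'_N=\mathrm{supp}(P'_N)$. Suppose that there exist $Q_s\in\mathcal P(\Xi)$ and $\hat P'_s\in\mathcal P(\Xi')$ with $I(\hat P'_s,Q_s)<r$ and $\mathrm{LP}(\hat P'_s,P'_N)<\delta$. Then $\tilde c^\delta(z,P'_N)$ equals the optimal value of the minimization problem $$\inf\ \ \beta r-\int_{\Xi'}v(\xi')\,dP'_N(\xi')+\gamma(\delta-1)+\max_{\xi\in\Xi}\left[\ell(z,\xi)+\beta\int_{\Xi'}\exp\left(\frac{u(\xi')}{\beta}-1\right)dO_\xi(\xi')\right]$$ over $\beta\ge0$, $u:\Xi'\to\mathbb R$, $v:\Xi'_N\to\mathbb R$, $\gamma\ge0$ subject to $$\gamma\,\mathbb 1\{\|\xi'-\xi'_i\|\le\delta\}+v(\xi'_i)\le u(\xi')\qquad\forall\xi'\in\Xi',\ \xi'_i\in\Xi'_N .$$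
   Context: $\Xi'$ is a Polish space (not necessarily finite), with distance written $\|s-s'\|$; $\mathcal P(\cdot)$ denotes Borel probability measures. $\ell:Z\times\Xi\to\mathbb R$ is a loss function. $O:\Xi\to\mathcal P(\Xi')$ is an observational model (Markov kernel), $(O\star Q)(B)=\int O_\xi(B)\,dQ(\xi)$, and $P'_N=\frac1N\sum_{i=1}^N\delta_{\xi'_i}$ is the empirical measure of noisy observations in $\Xi'$. The functions $u$ are measurable. $I(\hat P',Q)=\mathrm{KL}(\hat P',O\star Q)$ with $\mathrm{KL}$ the Kullback–Leibler divergence ($+\infty$ when the first argument is not absolutely continuous with respect to the second). $\mathrm{LP}$ is the Lévy–Prokhorov metric on $\mathcal P(\Xi')$, with $\mathrm{LP}(\hat P',P'_N)\le\delta$ iff $P'_N(B)\le\hat P'(B^\delta)+\delta$ for all Borel $B\subseteq\Xi'$, $B^\delta=\{s'\in\Xi':\|s-s'\|\le\delta\text{ for some }s\in B\}$. $I^\delta(\mu,\nu)=\inf\{I(\upsilon,\nu):\upsilon\in\mathcal P(\Xi'),\ \mathrm{LP}(\upsilon,\mu)\le\delta\}$. The predictor (with $\mathcal P=\mathcal P(\Xi)$) is $\tilde c^\delta(z,P'_N)=\sup\{\mathbf E_Q[\ell(z,\xi)]:Q\in\mathcal P(\Xi),\ I^\delta(P'_N,Q)\le r\}$, equivalently the supremum of $\mathbf E_Q[\ell(z,\xi)]$ over $Q\in\mathcal P(\Xi)$, $\hat P'\in\mathcal P(\Xi')$ with $I(\hat P',Q)\le r$, $\mathrm{LP}(\hat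 P',P'_N)\le\delta$. Convention at $\beta=0$: $\beta\exp(a/\beta-1)$ is understood as its limit when $\beta\downarrow0$, i.e. $0$ if $a\le0$ and $+\infty$ if $a>0$. *)

theory Defs
  imports "HOL-Probability.Probability" "HOL-Real_Asymp.Real_Asymp"
begin

text \<open>
  The sample space \<open>\<Xi>\<close> is a finite (discrete) type, so that its Borel probability measures are
  the pmfs on that type; the observation space \<open>\<Xi>'\<close> is a type of class \<^class>\<open>polish_space\<close>
  whose Borel probability measures are the elements of \<open>space (prob_algebra borel)\<close>.
\<close>

definition observed_law :: "('a \<Rightarrow> 'b::topological_space measure) \<Rightarrow> 'a pmf \<Rightarrow> 'b measure" where
  "observed_law Obs Q = measure_pmf Q \<bind> Obs"

text \<open>
  \<^const>\<open>KL_divergence\<close> takes the reference measure first, is a Bochner integral, and so returns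
  \<open>0\<close> when the log-density is not integrable. For probability measures the negative part of the
  log-density is always \<open>\<mu>\<close>-integrable, hence non-integrability means that the divergence is
  \<open>\<infinity>\<close>. Note that \<open>absolutely_continuous \<nu> \<mu>\<close> says that \<open>\<mu>\<close> is absolutely continuous with
  respect to \<open>\<nu>\<close>.
\<close>

definition KL :: "'b measure \<Rightarrow> 'b measure \<Rightarrow> ereal" where
  "KL \<mu> \<nu> =
    (if absolutely_continuous \<nu> \<mu> \<and> integrable \<mu> (entropy_density (exp 1) \<nu> \<mu>)
     then ereal (KL_divergence (exp 1) \<nu> \<mu>) else \<infinity>)"

definition rate :: "('a \<Rightarrow> 'b::topological_space measure) \<Rightarrow> 'b measure \<Rightarrow> 'a pmf \<Rightarrow> ereal" where
  "rate Obs \<mu> Q = KL \<mu> (observed_law Obs Q)"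

text \<open>
  The usual definition of the Levy-Prokhorov distance, through open \<open>\<epsilon>\<close>-enlargements (which are
  always measurable). The one-sided condition suffices for probability measures, see
  \<open>levy_prokhorov_commute\<close>; the description of \<open>levy_prokhorov \<mu> \<nu> \<le> \<delta>\<close> by closed
  enlargements for empirical \<open>\<nu>\<close> is \<open>levy_prokhorov_empirical_le_iff\<close>.
\<close>

definition levy_prokhorov :: "'b::metric_space measure \<Rightarrow> 'b measure \<Rightarrow> real" where
  "levy_prokhorov \<mu> \<nu> =
    Inf {\<epsilon>. 0 < \<epsilon> \<and> (\<forall>B\<in>sets borel. measure \<nu> B \<le> measure \<mu> (\<Union>b\<in>B. ball b \<epsilon>) + \<epsilon>)}"

definition smoothed_rate ::
  "('a \<Rightarrow> 'b::metric_space measure) \<Rightarrow> real \<Rightarrow> 'b measure \<Rightarrow> 'a pmf \<Rightarrow> ereal" where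
  "smoothed_rate Obs \<delta> \<mu> Q =
    (INF \<upsilon> \<in> {\<upsilon> \<in> space (prob_algebra borel). levy_prokhorov \<upsilon> \<mu> \<le> \<delta>}. rate Obs \<upsilon> Q)"

definition predictor ::
  "('z \<Rightarrow> 'a \<Rightarrow> real) \<Rightarrow> ('a \<Rightarrow> 'b::metric_space measure) \<Rightarrow> real \<Rightarrow> real \<Rightarrow> 'z \<Rightarrow> 'b measure \<Rightarrow> ereal"
  where
  "predictor loss Obs r \<delta> z \<mu> =
    (SUP Q \<in> {Q. smoothed_rate Obs \<delta> \<mu> Q \<le> ereal r}. ereal (measure_pmf.expectation Q (loss z)))"

definition empirical :: "nat \<Rightarrow> (nat \<Rightarrow> 'b::topological_space) \<Rightarrow> 'b measure" where
  "empirical N x = distr (uniform_count_measure {1..N}) borel x"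

definition supp :: "'b::topological_space measure \<Rightarrow> 'b set" where
  "supp \<mu> = {x. \<forall>U. open U \<and> x \<in> U \<longrightarrow> 0 < emeasure \<mu> U}"

text \<open>\<open>\<beta> exp (a / \<beta> - 1)\<close>, extended to \<open>\<beta> = 0\<close> by its limit for \<open>\<beta> \<down> 0\<close>.\<close>

definition scaled_exp :: "real \<Rightarrow> real \<Rightarrow> ennreal" where
  "scaled_exp \<beta> a =
    (if \<beta> = 0 then (if a \<le> 0 then 0 else \<infinity>) else ennreal (\<beta> * exp (a / \<beta> - 1)))"

lemma tendsto_scaled_exp_0: "((\<lambda>\<beta>. scaled_exp \<beta> a) \<longlongrightarrow> scaled_exp 0 a) (at_right 0)"
proof -
  have ev: "\<forall>\<^sub>F \<beta> in at_right 0. ennreal (\<beta> * exp (a / \<beta> - 1)) = scaled_exp \<beta> a"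
    using eventually_at_right_less[of "0::real"]
    by (rule eventually_mono) (simp add: scaled_exp_def)
  show ?thesis
  proof (cases "a \<le> 0")
    case True
    have "((\<lambda>\<beta>. \<beta> * exp (a / \<beta> - 1)) \<longlongrightarrow> 0) (at_right 0)"
    proof (rule tendsto_sandwich[of "\<lambda>_. 0" _ _ "\<lambda>\<beta>. \<beta>"])
      show "\<forall>\<^sub>F \<beta> in at_right 0. \<beta> * exp (a / \<beta> - 1) \<le> \<beta>"
        using eventually_at_right_less[of "0::real"]
      proof (rule eventually_mono)
        fix b :: real assume b: "0 < b"
        have "a / b \<le> 0" using True b by (simp add: divide_nonpos_pos)
        then have "exp (a / b - 1) \<le> 1" by (simp del: divide_le_0_iff)
        then show "b * exp (a / b - 1) \<le> b" using b mult_left_le by fastforce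
      qed
    qed (auto intro: eventually_mono[OF eventually_at_right_less[of "0::real"]]
           simp: tendsto_ident_at)
    from tendsto_ennrealI[OF this] show ?thesis
      using True by (intro Lim_transform_eventually[OF _ ev]) (simp add: scaled_exp_def)
  next
    case False
    then have "a > 0" by simp
    then have "filterlim (\<lambda>\<beta>. \<beta> * exp (a / \<beta> - 1)) at_top (at_right 0)"
      by real_asymp
    then have "((\<lambda>\<beta>. ennreal (\<beta> * exp (a / \<beta> - 1))) \<longlongrightarrow> \<infinity>) (at_right 0)"
      unfolding infinity_ennreal_def by (rule iffD2[OF ennreal_tendsto_top_eq_at_top])
    then show ?thesis
      using False by (intro Lim_transform_eventually[OF _ ev]) (simp add: scaled_exp_def)
  qed
qed

lemma prob_space_empirical:
  assumes "1 \<le> N" shows "empirical N x \<in> space (prob_algebra borel)"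
  unfolding space_prob_algebra empirical_def using assms
  by (auto intro!: prob_space.prob_space_distr prob_space_uniform_count_measure
      simp: measurable_def space_uniform_count_measure sets_uniform_count_measure)

lemma emeasure_empirical:
  assumes "1 \<le> N" and B: "B \<in> sets borel"
  shows "emeasure (empirical N x) B = (\<Sum>i=1..N. emeasure (return borel (x i)) B) / of_nat N"
proof -
  have "emeasure (empirical N x) B = emeasure (uniform_count_measure {1..N}) (x -` B \<inter> {1..N})"
    unfolding empirical_def using B
    by (subst emeasure_distr)
      (auto simp: measurable_def space_uniform_count_measure sets_uniform_count_measure)
  also have "\<dots> = ennreal (card (x -` B \<inter> {1..N}) / N)"
    by (subst emeasure_uniform_count_measure) auto
  also have "\<dots> = of_nat (card (x -` B \<inter> {1..N})) / of_nat N"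
    using assms(1) by (simp add: divide_ennreal[symmetric] ennreal_of_nat_eq_real_of_nat)
  also have "of_nat (card (x -` B \<inter> {1..N})) = (\<Sum>i=1..N. emeasure (return borel (x i)) B)"
    using B by (simp add: indicator_def sum.If_cases Int_def vimage_def conj_commute)
  finally show ?thesis .
qed

lemma supp_empirical:
  fixes x :: "nat \<Rightarrow> 'b::metric_space"
  assumes N: "1 \<le> N" shows "supp (empirical N x) = x ` {1..N}"
proof (intro set_eqI iffI)
  fix y assume y: "y \<in> supp (empirical N x)"
  show "y \<in> x ` {1..N}"
  proof (rule ccontr)
    assume n: "y \<notin> x ` {1..N}"
    have o: "open (- x ` {1..N})" by (intro open_Compl finite_imp_closed) auto
    then have "emeasure (empirical N x) (- x ` {1..N}) = 0"
      using N by (subst emeasure_empirical) (auto simp: sum_nonneg_eq_0_iff)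
    with y n o show False unfolding supp_def by auto
  qed
next
  fix y assume "y \<in> x ` {1..N}"
  then obtain i where i: "i \<in> {1..N}" "y = x i" by auto
  show "y \<in> supp (empirical N x)"
    unfolding supp_def
  proof safe
    fix U assume U: "open U" "y \<in> U"
    have "emeasure (return borel (x i)) U \<le> (\<Sum>i=1..N. emeasure (return borel (x i)) U)"
      using i by (intro member_le_sum) auto
    moreover have "emeasure (return borel (x i)) U = 1"
      using U i by (simp add: borel_open)
    ultimately have "(\<Sum>i=1..N. emeasure (return borel (x i)) U) \<noteq> 0"
      by (metis not_one_le_zero)
    then show "0 < emeasure (empirical N x) U"
      using N U by (subst emeasure_empirical) (auto simp: zero_less_iff_neq_zero ennreal_divide_eq_0_iff)
  qed
qed

lemma levy_prokhorov_commute: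
  fixes \<mu> \<nu> :: "'b::metric_space measure"
  assumes "\<mu> \<in> space (prob_algebra borel)" "\<nu> \<in> space (prob_algebra borel)"
  shows "levy_prokhorov \<mu> \<nu> = levy_prokhorov \<nu> \<mu>"
proof -
  have *: "measure \<nu> A \<le> measure \<mu> (\<Union>a\<in>A. ball a \<epsilon>) + \<epsilon>"
    if m: "\<mu> \<in> space (prob_algebra borel)" "\<nu> \<in> space (prob_algebra borel)"
      and h: "\<forall>B\<in>sets borel. measure \<mu> B \<le> measure \<nu> (\<Union>b\<in>B. ball b \<epsilon>) + \<epsilon>" and A: "A \<in> sets borel"
    for \<mu> \<nu> :: "'b measure" and \<epsilon> A
  proof -
    interpret M: prob_space \<mu> using m by (simp add: space_prob_algebra)
    interpret V: prob_space \<nu> using m by (simp add: space_prob_algebra)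
    have s: "sets \<mu> = sets borel" "sets \<nu> = sets borel" using m by (auto simp: space_prob_algebra)
    note sp = sets_eq_imp_space_eq[OF s(1)] sets_eq_imp_space_eq[OF s(2)]
    let ?E = "\<Union>a\<in>A. ball a \<epsilon>"
    have E: "?E \<in> sets borel" by (intro borel_open) auto
    have "1 - measure \<mu> ?E = measure \<mu> (- ?E)"
      using M.prob_compl[of ?E] E s sp by (simp add: Compl_eq_Diff_UNIV)
    also have "\<dots> \<le> measure \<nu> (\<Union>b\<in>- ?E. ball b \<epsilon>) + \<epsilon>"
      by (rule bspec[OF h]) (intro borel_closed closed_Compl open_UN ballI open_ball)
    also have "measure \<nu> (\<Union>b\<in>- ?E. ball b \<epsilon>) \<le> measure \<nu> (- A)"
      using A s by (intro V.finite_measure_mono) (auto, metis dist_commute)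
    also have "measure \<nu> (- A) = 1 - measure \<nu> A"
      using V.prob_compl[of A] A s sp by (simp add: Compl_eq_Diff_UNIV)
    finally show ?thesis by simp
  qed
  have "(\<forall>B\<in>sets borel. measure \<nu> B \<le> measure \<mu> (\<Union>b\<in>B. ball b \<epsilon>) + \<epsilon>) \<longleftrightarrow>
      (\<forall>B\<in>sets borel. measure \<mu> B \<le> measure \<nu> (\<Union>b\<in>B. ball b \<epsilon>) + \<epsilon>)" for \<epsilon>
    using *[OF assms] *[OF assms(2,1)] by blast
  then show ?thesis unfolding levy_prokhorov_def by simp
qed

text \<open>
  The closed enlargement of a Borel set need not be Borel (it is analytic), hence the outer measure.
\<close>

lemma levy_prokhorov_empirical_le_iff:
  fixes \<mu> :: "'b::metric_space measure"
  assumes \<mu>: "\<mu> \<in> space (prob_algebra borel)" and N: "1 \<le> N" and \<delta>: "0 \<le> \<delta>"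
  shows "levy_prokhorov \<mu> (empirical N x) \<le> \<delta> \<longleftrightarrow>
    (\<forall>B\<in>sets borel. emeasure (empirical N x) B
       \<le> outer_measure_of \<mu> {s'. \<exists>s\<in>B. dist s s' \<le> \<delta>} + ennreal \<delta>)"
proof -
  let ?P = "empirical N x"
  define S where "S = {\<epsilon>. 0 < \<epsilon> \<and> (\<forall>B\<in>sets borel. measure ?P B \<le> measure \<mu> (\<Union>b\<in>B. ball b \<epsilon>) + \<epsilon>)}"
  have LP: "levy_prokhorov \<mu> ?P = Inf S" by (simp add: levy_prokhorov_def S_def)
  interpret M: prob_space \<mu> using \<mu> by (simp add: space_prob_algebra)
  interpret P: prob_space ?P using prob_space_empirical[OF N, of x] by (simp add: space_prob_algebra)
  have s: "sets \<mu> = sets borel" "sets ?P = sets borel"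
    using \<mu> prob_space_empirical[OF N] by (auto simp: space_prob_algebra)
  have bdd: "bdd_below S" unfolding S_def by (auto intro!: bdd_belowI[of _ 0])
  have "1 \<in> S" unfolding S_def using P.prob_le_1 by (auto intro: add_increasing)
  then have ne: "S \<noteq> {}" by auto
  show ?thesis
  proof
    assume le: "levy_prokhorov \<mu> ?P \<le> \<delta>"
    show "\<forall>B\<in>sets borel. emeasure ?P B
       \<le> outer_measure_of \<mu> {s'. \<exists>s\<in>B. dist s s' \<le> \<delta>} + ennreal \<delta>"
    proof
      fix B :: "'b set" assume B: "B \<in> sets borel"
      define F where "F = B \<inter> x ` {1..N}"
      have F: "finite F" "F \<subseteq> B" by (auto simp: F_def)
      have Fs: "F \<in> sets borel" using F by (intro borel_closed finite_imp_closed)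
      have PF: "emeasure ?P B = emeasure ?P F"
        using N B Fs by (subst (1 2) emeasure_empirical)
          (auto intro!: arg_cong2[where f="(/)"] sum.cong simp: F_def indicator_def)
      define U where "U n = (\<Union>b\<in>F. ball b (\<delta> + 1 / real (Suc n)))" for n
      define C where "C = (\<Union>b\<in>F. cball b \<delta>)"
      have Us: "range U \<subseteq> sets \<mu>" unfolding U_def s by (auto intro!: borel_open)
      have Cs: "C \<in> sets \<mu>" unfolding C_def s using F by (intro borel_closed closed_UN) auto
      have dec: "decseq U"
        unfolding decseq_def U_def
      proof (intro allI impI UN_mono subset_ball)
        fix m n :: nat assume "m \<le> n"
        then show "\<delta> + 1 / real (Suc n) \<le> \<delta> + 1 / real (Suc m)" by (simp add: frac_le)
      qed auto
      have INT: "(\<Inter>n. U n) = C"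
      proof (intro set_eqI iffI)
        fix y assume y: "y \<in> (\<Inter>n. U n)"
        show "y \<in> C"
        proof (rule ccontr)
          assume "y \<notin> C"
          then have g: "\<And>b. b \<in> F \<Longrightarrow> \<delta> < dist b y" by (auto simp: C_def not_le)
          have "F \<noteq> {}" using y by (auto simp: U_def)
          define m where "m = Min ((\<lambda>b. dist b y) ` F)"
          have "\<delta> < m" unfolding m_def using F g \<open>F \<noteq> {}\<close> by simp
          then obtain n where n: "1 / real (Suc n) < m - \<delta>"
            using nat_approx_posE[of "m - \<delta>"] by auto
          from y obtain b where "b \<in> F" "dist b y < \<delta> + 1 / real (Suc n)"
            unfolding U_def by auto
          moreover have "m \<le> dist b y" unfolding m_def using F \<open>b \<in> F\<close> by simp
          ultimately show False using n by simp
        qed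
      next
        fix y assume "y \<in> C"
        then obtain b where b: "b \<in> F" "dist b y \<le> \<delta>" by (auto simp: C_def)
        show "y \<in> (\<Inter>n. U n)"
        proof
          fix n have "0 < 1 / real (Suc n)" by simp
          then have "dist b y < \<delta> + 1 / real (Suc n)" using b by linarith
          then show "y \<in> U n" using b by (auto simp: U_def)
        qed
      qed
      have conv: "(\<lambda>n. measure \<mu> (U n) + (\<delta> + 1 / real (Suc n))) \<longlonglongrightarrow> measure \<mu> C + (\<delta> + 0)"
        using M.finite_Lim_measure_decseq[OF Us dec] INT
        by (intro tendsto_add tendsto_const lim_1_over_n LIMSEQ_Suc) auto
      have "measure ?P F \<le> measure \<mu> C + (\<delta> + 0)"
      proof (rule LIMSEQ_le_const[OF conv], intro exI allI impI)
        fix n :: nat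
        have "0 < 1 / real (Suc n)" by simp
        then have "Inf S < \<delta> + 1 / real (Suc n)" using le LP by linarith
        then obtain e where e: "e \<in> S" "e < \<delta> + 1 / real (Suc n)"
          using cInf_less_iff[OF ne bdd] by auto
        have "measure ?P F \<le> measure \<mu> (\<Union>b\<in>F. ball b e) + e" using e Fs by (simp add: S_def)
        also have "measure \<mu> (\<Union>b\<in>F. ball b e) \<le> measure \<mu> (U n)"
          using Us e(2) unfolding U_def by (intro M.finite_measure_mono UN_mono subset_ball) auto
        finally show "measure ?P F \<le> measure \<mu> (U n) + (\<delta> + 1 / real (Suc n))" using e by simp
      qed
      then have "ennreal (measure ?P F) \<le> ennreal (measure \<mu> C + \<delta>)" by (simp add: ennreal_leI)
      then have "emeasure ?P F \<le> emeasure \<mu> C + ennreal \<delta>"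
        using \<delta> by (simp add: M.emeasure_eq_measure P.emeasure_eq_measure)
      also have "emeasure \<mu> C \<le> outer_measure_of \<mu> {s'. \<exists>s\<in>B. dist s s' \<le> \<delta>}"
        unfolding outer_measure_of_eq[OF Cs, symmetric]
        using F by (intro outer_measure_of_mono) (auto simp: C_def)
      finally show "emeasure ?P B \<le> outer_measure_of \<mu> {s'. \<exists>s\<in>B. dist s s' \<le> \<delta>} + ennreal \<delta>"
        using PF by simp
    qed
  next
    assume h: "\<forall>B\<in>sets borel. emeasure ?P B
       \<le> outer_measure_of \<mu> {s'. \<exists>s\<in>B. dist s s' \<le> \<delta>} + ennreal \<delta>"
    have "e \<in> S" if e: "\<delta> < e" for e
      unfolding S_def
    proof safe
      show "0 < e" using e \<delta> by simp
      fix B :: "'b set" assume B: "B \<in> sets borel"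
      let ?E = "\<Union>b\<in>B. ball b e"
      have E: "?E \<in> sets \<mu>" unfolding s by (intro borel_open) auto
      have "emeasure ?P B \<le> outer_measure_of \<mu> {s'. \<exists>s\<in>B. dist s s' \<le> \<delta>} + ennreal \<delta>"
        using h B by blast
      also have "\<dots> \<le> outer_measure_of \<mu> ?E + ennreal e"
        using e by (intro add_mono outer_measure_of_mono ennreal_leI) auto
      also have "\<dots> = ennreal (measure \<mu> ?E + e)"
        using E e \<delta> by (simp add: M.emeasure_eq_measure)
      finally show "measure ?P B \<le> measure \<mu> ?E + e"
        unfolding P.emeasure_eq_measure using e \<delta> by (subst (asm) ennreal_le_iff) auto
    qed
    then have "\<And>e. \<delta> < e \<Longrightarrow> Inf S \<le> e" using cInf_lower[OF _ bdd] by blast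
    then show "levy_prokhorov \<mu> ?P \<le> \<delta>" unfolding LP by (rule dense_ge)
  qed
qed

end

theory Submission
  imports Defs
begin

text \<open>
  The claim is Lagrange duality for the problem of maximising \<open>E\<^sub>Q loss\<close> over \<open>Q\<close> and an observation law
  \<open>\<upsilon>\<close> subject to \<open>KL \<upsilon> (observed_law Obs Q) \<le> r\<close> and \<open>levy_prokhorov \<upsilon> P \<le> \<delta>\<close>, where \<open>P\<close> is empirical.

  Weak duality is the sum of two inequalities for a dual feasible \<open>(\<beta>, u, v, \<gamma>)\<close>. The
  Levy--Prokhorov constraint gives \<open>\<integral>u d\<upsilon> \<ge> \<integral>v dP + \<gamma> (1 - \<delta>)\<close> by the layer-cake formula
  (\<open>transport_dual_le\<close>), and the Fenchel--Young inequality for the entropy gives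
  \<open>\<integral>u d\<upsilon> \<le> \<beta> KL \<upsilon> (observed_law Obs Q) + \<integral>\<beta> exp (u / \<beta> - 1) d(observed_law Obs Q)\<close>
  (\<open>integral_le_rate_plus_scaled_exp\<close>).

  For strong duality, three observations make elementary Lagrange multipliers sufficient although
  \<open>\<upsilon>\<close> ranges over an infinite-dimensional set. As \<open>P\<close> has finite support, the Levy--Prokhorov ball
  is described by one linear constraint \<open>P F \<le> \<upsilon> (E F) + \<delta>\<close> for each subset \<open>F\<close> of the support, where
  \<open>E F\<close> is the closed \<open>\<delta>\<close>-enlargement of \<open>F\<close>; so there are only finitely many constraints
  (\<open>levy_prokhorov_empirical_le_iff_finite\<close>). The problem becomes convex if \<open>\<upsilon>\<close> is split into parts with
  densities \<open>\<rho> \<xi>\<close> relative to \<open>Obs \<xi>\<close> and the divergence is taken jointly in \<open>\<xi>\<close> and the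
  observation. This neither adds feasible \<open>Q\<close> (\<open>rate_mixture_le\<close>) nor destroys the
  Slater point (\<open>slater_admissibleE\<close>). Finally, multipliers for finitely many constraints exist by
  comparing slopes of chords, one constraint at a time (\<open>multipliers_inequalities\<close>).

  The multiplier \<open>\<beta>\<close> of the divergence bound, the multipliers of the sets \<open>F\<close> and that of the normalisation
  combine into a dual feasible point. Maximising the Lagrangian over the densities turns
  the entropy into \<open>scaled_exp\<close> and shows that the value of this point is at most that of the primal problem
  (\<open>dual_attainedE\<close>).
\<close>

section \<open>Lagrange multipliers for finitely many constraints\<close>

lemma exists_separating_real:
  fixes L U :: "real set"
  assumes "L \<noteq> {}" "U \<noteq> {}" "\<And>l u. l \<in> L \<Longrightarrow> u \<in> U \<Longrightarrow> l \<le> u"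
  obtains c where "\<And>l. l \<in> L \<Longrightarrow> l \<le> c" "\<And>u. u \<in> U \<Longrightarrow> c \<le> u"
proof
  have "bdd_above L" using assms by (meson bdd_above.I ex_in_conv)
  then show "\<And>l. l \<in> L \<Longrightarrow> l \<le> Sup L" by (rule cSup_upper[rotated])
  show "\<And>u. u \<in> U \<Longrightarrow> Sup L \<le> u" using assms by (intro cSup_least) auto
qed

text \<open>
  The convexity that Lagrange duality needs, without a vector space: two points can be mixed into one
  that is at least as good as the convex combination, both for the objective \<open>f\<close> and for
  every constraint \<open>g j \<le> 0\<close>. This suits points that are pairs of a pmf and a family of densities.
\<close>

definition concavelike :: "'x set \<Rightarrow> ('x \<Rightarrow> real) \<Rightarrow> 'j set \<Rightarrow> ('j \<Rightarrow> 'x \<Rightarrow> real) \<Rightarrow> bool" where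
  "concavelike X f J g \<longleftrightarrow>
    (\<forall>x\<in>X. \<forall>y\<in>X. \<forall>c\<in>{0<..<1}. \<exists>w\<in>X. c * f x + (1 - c) * f y \<le> f w \<and>
       (\<forall>j\<in>J. g j w \<le> c * g j x + (1 - c) * g j y))"

lemma concavelikeE:
  assumes "concavelike X f J g" "x \<in> X" "y \<in> X" "0 < c" "c < 1"
  obtains w where "w \<in> X" "c * f x + (1 - c) * f y \<le> f w"
    "\<And>j. j \<in> J \<Longrightarrow> g j w \<le> c * g j x + (1 - c) * g j y"
  using assms unfolding concavelike_def by (meson greaterThanLessThan_iff)

lemma chord_at_zero_le:
  fixes p q g\<^sub>x g\<^sub>y V :: real
  assumes "g\<^sub>x < 0" "0 < g\<^sub>y"
    and "\<And>c. 0 < c \<Longrightarrow> c < 1 \<Longrightarrow> c * g\<^sub>x + (1 - c) * g\<^sub>y = 0 \<Longrightarrow> c * p + (1 - c) * q \<le> V"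
  shows "(q - V) / g\<^sub>y \<le> (p - V) / g\<^sub>x"
proof -
  define c where "c = g\<^sub>y / (g\<^sub>y - g\<^sub>x)"
  have c: "0 < c" "c < 1" using assms by (auto simp: c_def field_simps)
  have d: "g\<^sub>y - g\<^sub>x > 0" using assms by simp
  have 1: "1 - c = - g\<^sub>x / (g\<^sub>y - g\<^sub>x)" using d by (simp add: c_def field_simps)
  have "c * g\<^sub>x + (1 - c) * g\<^sub>y = 0" unfolding 1 using d by (simp add: c_def field_simps)
  then have "c * p + (1 - c) * q \<le> V" using c assms(3) by blast
  then have "(g\<^sub>y * p - g\<^sub>x * q) / (g\<^sub>y - g\<^sub>x) \<le> V"
    unfolding 1 unfolding c_def by (simp add: diff_divide_distrib)
  then have "g\<^sub>y * p - g\<^sub>x * q \<le> V * (g\<^sub>y - g\<^sub>x)" using d by (simp add: pos_divide_le_eq)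
  then have "(q - V) * (- g\<^sub>x) \<le> (V - p) * g\<^sub>y" by (simp add: algebra_simps)
  then have "(q - V) / g\<^sub>y \<le> (V - p) / (- g\<^sub>x)"
    using assms(1,2) by (subst frac_le_eq[symmetric] | simp add: field_simps)+
  then show ?thesis by (simp add: minus_divide_left[symmetric] diff_divide_distrib)
qed

text \<open>
  In the plane of the pairs \<open>(g x, f x)\<close>, the required line passes through \<open>(0, V)\<close> and lies above all
  of them. Its slope must be at least the slopes towards the points on the right and at most those
  towards the points on the left; a violation would be a chord passing above \<open>(0, V)\<close>.
  The parameter \<open>m\<close> lets the slope be bounded below as well.
\<close>

lemma separating_slope:
  fixes f g :: "'x \<Rightarrow> real"
  assumes chord: "\<And>x y c. x \<in> X \<Longrightarrow> y \<in> X \<Longrightarrow> g x < 0 \<Longrightarrow> 0 < g y \<Longrightarrow> 0 < c \<Longrightarrow> c < 1 \<Longrightarrow>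
      c * g x + (1 - c) * g y = 0 \<Longrightarrow> c * f x + (1 - c) * f y \<le> V"
    and zero: "\<And>x. x \<in> X \<Longrightarrow> g x = 0 \<Longrightarrow> f x \<le> V"
    and neg: "s \<in> X" "g s < 0"
    and least: "\<And>x. x \<in> X \<Longrightarrow> g x < 0 \<Longrightarrow> m \<le> (f x - V) / g x"
  obtains c where "m \<le> c" "\<And>x. x \<in> X \<Longrightarrow> f x \<le> V + c * g x"
proof -
  define L where "L = insert m {(f y - V) / g y | y. y \<in> X \<and> 0 < g y}"
  define U where "U = {(f y - V) / g y | y. y \<in> X \<and> g y < 0}"
  have "l \<le> u" if lu: "l \<in> L" "u \<in> U" for l u
  proof -
    obtain y where y: "u = (f y - V) / g y" "y \<in> X" "g y < 0" using lu by (auto simp: U_def)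
    show ?thesis
    proof (cases "l = m")
      case True then show ?thesis using least y by simp
    next
      case False
      then obtain x where x: "l = (f x - V) / g x" "x \<in> X" "0 < g x"
        using lu by (auto simp: L_def)
      show ?thesis unfolding x y
        using chord[OF y(2) x(2) y(3) x(3)] by (rule chord_at_zero_le[OF y(3) x(3)])
    qed
  qed
  moreover have "L \<noteq> {}" "U \<noteq> {}" using neg by (auto simp: L_def U_def)
  ultimately obtain c where c: "\<And>l. l \<in> L \<Longrightarrow> l \<le> c" "\<And>u. u \<in> U \<Longrightarrow> c \<le> u"
    using exists_separating_real by metis
  show ?thesis
  proof
    show "m \<le> c" using c(1)[of m] by (simp add: L_def)
    fix x assume x: "x \<in> X"
    consider "g x < 0" | "g x = 0" | "0 < g x" by linarith
    then show "f x \<le> V + c * g x"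
    proof cases
      case 1
      then have "c \<le> (f x - V) / g x" using x by (intro c(2)) (auto simp: U_def)
      then show ?thesis using 1 by (simp add: neg_le_divide_eq algebra_simps)
    next
      case 2 then show ?thesis using zero[OF x] by simp
    next
      case 3
      then have "(f x - V) / g x \<le> c" using x by (intro c(1)) (auto simp: L_def)
      then show ?thesis using 3 by (simp add: pos_divide_le_eq algebra_simps)
    qed
  qed
qed

text \<open>
  For the constraint \<open>g j \<le> 0\<close>, the points on the left are feasible and hence have
  value at most \<open>V\<close>, so all slopes towards them are nonnegative and \<open>m = 0\<close> is possible.
\<close>

lemma multiplier_inequality:
  assumes cv: "concavelike X f {j} g" and slater: "s \<in> X" "g j s < 0"
    and V: "\<And>x. x \<in> X \<Longrightarrow> g j x \<le> 0 \<Longrightarrow> f x \<le> V"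
  obtains c where "0 \<le> c" "\<And>x. x \<in> X \<Longrightarrow> f x \<le> V + c * g j x"
proof (rule separating_slope[where f = f and g = "g j" and V = V and m = 0])
  fix x y c assume xy: "x \<in> X" "y \<in> X" and c: "0 < c" "c < 1" and z: "c * g j x + (1 - c) * g j y = 0"
  obtain w where "w \<in> X" "c * f x + (1 - c) * f y \<le> f w" "g j w \<le> c * g j x + (1 - c) * g j y"
    using concavelikeE[OF cv xy c] by blast
  then show "c * f x + (1 - c) * f y \<le> V" using z V[of w] by linarith
next
  show "0 \<le> (f x - V) / g j x" if "x \<in> X" "g j x < 0" for x
    using V[of x] that by (simp add: zero_le_divide_iff)
next
  fix c assume "0 \<le> c" and le: "\<And>x. x \<in> X \<Longrightarrow> f x \<le> V + c * g j x"
  then show thesis by (rule that)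
qed (use V slater in auto)

text \<open>
  For an affine constraint \<open>e = 0\<close> the multiplier has no sign, and points on both sides of the
  constraint replace the Slater point.
\<close>

lemma multiplier_equality:
  fixes f e :: "'x \<Rightarrow> real"
  assumes cv: "\<And>x y c. x \<in> X \<Longrightarrow> y \<in> X \<Longrightarrow> 0 < c \<Longrightarrow> c < 1 \<Longrightarrow>
      \<exists>w\<in>X. c * f x + (1 - c) * f y \<le> f w \<and> e w = c * e x + (1 - c) * e y"
    and neg: "a \<in> X" "e a < 0" and pos: "b \<in> X" "0 < e b"
    and V: "\<And>x. x \<in> X \<Longrightarrow> e x = 0 \<Longrightarrow> f x \<le> V"
  obtains c where "\<And>x. x \<in> X \<Longrightarrow> f x \<le> V + c * e x"
proof -
  have chord: "c * f x + (1 - c) * f y \<le> V"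
    if xy: "x \<in> X" "y \<in> X" and c: "0 < c" "c < 1" and z: "c * e x + (1 - c) * e y = 0" for x y c
  proof -
    obtain w where "w \<in> X" "c * f x + (1 - c) * f y \<le> f w" "e w = c * e x + (1 - c) * e y"
      using cv[OF xy c] by blast
    then show ?thesis using z V[of w] by linarith
  qed
  show ?thesis
  proof (rule separating_slope[where X = X and f = f and g = e and V = V and m = "(f b - V) / e b"])
    show "(f b - V) / e b \<le> (f x - V) / e x" if x: "x \<in> X" "e x < 0" for x
      using chord[OF x(1) pos(1)] by (rule chord_at_zero_le[OF x(2) pos(2)])
  next
    fix c assume "\<And>x. x \<in> X \<Longrightarrow> f x \<le> V + c * e x"
    then show thesis by (rule that)
  qed (use chord V neg in auto)
qed

text \<open>
  One constraint is priced at a time, on the set cut out by the remaining ones. A point that is strictly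
  feasible for all constraints stays strictly feasible at every stage, and subtracting the
  priced constraint from the objective keeps the problem concave.
\<close>

lemma multipliers_inequalities:
  assumes "finite J" and "concavelike X f J g" and "s \<in> X" "\<And>j. j \<in> J \<Longrightarrow> g j s < 0"
    and "\<And>x. x \<in> X \<Longrightarrow> (\<And>j. j \<in> J \<Longrightarrow> g j x \<le> 0) \<Longrightarrow> f x \<le> V"
  obtains c where "\<And>j. j \<in> J \<Longrightarrow> (0::real) \<le> c j" "\<And>x. x \<in> X \<Longrightarrow> f x \<le> V + (\<Sum>j\<in>J. c j * g j x)"
  using assms
proof (induction J arbitrary: f thesis rule: finite_induct)
  case empty then show ?case by auto
next
  case (insert k J)
  note cv = insert.prems(2) and s = insert.prems(3,4)
  define X' where "X' = {x \<in> X. \<forall>j\<in>J. g j x \<le> 0}"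
  have "concavelike X' f {k} g"
    unfolding concavelike_def
  proof (intro ballI)
    fix x y c assume x: "x \<in> X'" and y: "y \<in> X'" and c: "c \<in> {0<..<1::real}"
    obtain w where w: "w \<in> X" "c * f x + (1 - c) * f y \<le> f w"
      "\<And>j. j \<in> insert k J \<Longrightarrow> g j w \<le> c * g j x + (1 - c) * g j y"
      using concavelikeE[OF cv, of x y c] x y c by (auto simp: X'_def)
    have "g j w \<le> 0" if "j \<in> J" for j
    proof -
      have "c * g j x \<le> 0" "(1 - c) * g j y \<le> 0"
        using x y c that by (auto simp: X'_def mult_le_0_iff)
      then show ?thesis using w(3)[of j] that by simp
    qed
    then show "\<exists>w\<in>X'. c * f x + (1 - c) * f y \<le> f w \<and>
       (\<forall>j\<in>{k}. g j w \<le> c * g j x + (1 - c) * g j y)"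
      using w by (auto simp: X'_def)
  qed
  moreover have "s \<in> X'" using s by (auto simp: X'_def intro: less_imp_le)
  moreover have "g k s < 0" using s by simp
  moreover have "f x \<le> V" if "x \<in> X'" "g k x \<le> 0" for x
    using that insert.prems(5)[of x] by (auto simp: X'_def)
  ultimately obtain d where d: "0 \<le> d" "\<And>x. x \<in> X' \<Longrightarrow> f x \<le> V + d * g k x"
    using multiplier_inequality[where X = X' and f = f and j = k and g = g and s = s and V = V]
    by blast
  define f' where "f' x = f x - d * g k x" for x
  have cv': "concavelike X f' J g"
    unfolding concavelike_def
  proof (intro ballI)
    fix x y c assume x: "x \<in> X" and y: "y \<in> X" and c: "c \<in> {0<..<1::real}"
    obtain w where w: "w \<in> X" "c * f x + (1 - c) * f y \<le> f w"
      "\<And>j. j \<in> insert k J \<Longrightarrow> g j w \<le> c * g j x + (1 - c) * g j y"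
      using concavelikeE[OF cv, of x y c] x y c by auto
    have "d * g k w \<le> d * (c * g k x + (1 - c) * g k y)"
      using d(1) w(3) by (intro mult_left_mono) auto
    then have "c * f' x + (1 - c) * f' y \<le> f' w"
      using w(2) by (simp add: f'_def algebra_simps)
    then show "\<exists>w\<in>X. c * f' x + (1 - c) * f' y \<le> f' w \<and>
       (\<forall>j\<in>J. g j w \<le> c * g j x + (1 - c) * g j y)"
      using w by auto
  qed
  have V': "f' x \<le> V" if "x \<in> X" "\<And>j. j \<in> J \<Longrightarrow> g j x \<le> 0" for x
    using that d(2)[of x] by (auto simp: X'_def f'_def)
  obtain c where c: "\<And>j. j \<in> J \<Longrightarrow> 0 \<le> c j" "\<And>x. x \<in> X \<Longrightarrow> f' x \<le> V + (\<Sum>j\<in>J. c j * g j x)"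
    using insert.IH[OF _ cv' s(1) _ V'] s(2) by blast
  have sum: "(\<Sum>j\<in>insert k J. (c(k := d)) j * g j x) = d * g k x + (\<Sum>j\<in>J. c j * g j x)" for x
    using insert.hyps by (auto intro!: sum.cong)
  show ?case
  proof (rule insert.prems(1))
    show "\<And>j. j \<in> insert k J \<Longrightarrow> 0 \<le> (c(k := d)) j" using c(1) d(1) by auto
    show "\<And>x. x \<in> X \<Longrightarrow> f x \<le> V + (\<Sum>j\<in>insert k J. (c(k := d)) j * g j x)"
      using c(2) unfolding sum f'_def by (simp add: algebra_simps)
  qed
qed

section \<open>The entropy integrand\<close>

text \<open>
  The integrand of the Kullback--Leibler divergence of densities \<open>a\<close> and \<open>b\<close>. The terms
  \<open>- a + b\<close> cancel for probability measures but make the integrand pointwise nonnegative, so that it can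
  be integrated without regard to negative parts. For \<open>b = 0 < a\<close> the value ought to be \<open>\<infinity>\<close>; below
  this case is always excluded by the condition \<open>b = 0 \<longrightarrow> a = 0\<close>.
\<close>

definition rel_ent :: "real \<Rightarrow> real \<Rightarrow> real" where
  "rel_ent a b = a * ln (a / b) - a + b"

lemma measurable_rel_ent[measurable]:
  assumes [measurable]: "f \<in> borel_measurable M" "g \<in> borel_measurable M"
  shows "(\<lambda>s. rel_ent (f s) (g s)) \<in> borel_measurable M"
  unfolding rel_ent_def by measurable

text \<open>
  The Fenchel--Young inequality for \<open>exp\<close>; equality holds for \<open>y = ln (a / b)\<close>, so it also presents \<open>rel_ent\<close>
  as a supremum of linear functions.
\<close>

lemma rel_ent_ge_tangent:
  assumes "0 \<le> a" "0 \<le> b" "b = 0 \<longrightarrow> a = 0"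
  shows "a * y - b * (exp y - 1) \<le> rel_ent a b"
proof (cases "a = 0")
  case True then show ?thesis using assms by (simp add: rel_ent_def algebra_simps)
next
  case False
  then have a: "0 < a" and b: "0 < b" using assms by auto
  have "a * (1 + (y - ln (a / b))) \<le> a * exp (y - ln (a / b))"
    using a by (intro mult_left_mono exp_ge_add_one_self) auto
  also have "\<dots> = b * exp y" using a b by (simp add: exp_diff)
  finally show ?thesis by (simp add: rel_ent_def algebra_simps)
qed

lemma rel_ent_nonneg: "0 \<le> a \<Longrightarrow> 0 \<le> b \<Longrightarrow> b = 0 \<longrightarrow> a = 0 \<Longrightarrow> 0 \<le> rel_ent a b"
  using rel_ent_ge_tangent[of a b 0] by simp

text \<open>
  A supremum of linear functions is sublinear: use at every summand the tangent
  that is optimal for the sum.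
\<close>

lemma rel_ent_sum_le:
  assumes fin: "finite I" and k: "\<And>i. i \<in> I \<Longrightarrow> 0 \<le> k i"
    and ab: "\<And>i. i \<in> I \<Longrightarrow> 0 \<le> a i" "\<And>i. i \<in> I \<Longrightarrow> 0 \<le> b i" "\<And>i. i \<in> I \<Longrightarrow> b i = 0 \<longrightarrow> a i = 0"
  shows "rel_ent (\<Sum>i\<in>I. k i * a i) (\<Sum>i\<in>I. k i * b i) \<le> (\<Sum>i\<in>I. k i * rel_ent (a i) (b i))"
proof -
  define A B where "A = (\<Sum>i\<in>I. k i * a i)" and "B = (\<Sum>i\<in>I. k i * b i)"
  have nn: "0 \<le> A" "0 \<le> B" unfolding A_def B_def using k ab by (auto intro!: sum_nonneg)
  show ?thesis
  proof (cases "A = 0")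
    case True
    then have "\<And>i. i \<in> I \<Longrightarrow> k i * a i = 0"
      unfolding A_def using fin k ab by (subst (asm) sum_nonneg_eq_0_iff) auto
    then have "k i * rel_ent (a i) (b i) = k i * b i" if "i \<in> I" for i
      using that by (auto simp: rel_ent_def)
    then have "(\<Sum>i\<in>I. k i * rel_ent (a i) (b i)) = B" unfolding B_def by (auto intro: sum.cong)
    then show ?thesis using True by (simp add: A_def[symmetric] B_def[symmetric] rel_ent_def)
  next
    case False
    have "B \<noteq> 0"
    proof
      assume "B = 0"
      then have "\<And>i. i \<in> I \<Longrightarrow> k i * b i = 0"
        unfolding B_def using fin k ab by (subst (asm) sum_nonneg_eq_0_iff) auto
      then have "\<And>i. i \<in> I \<Longrightarrow> k i * a i = 0" using ab(3) by auto
      then have "A = 0" unfolding A_def by (rule sum.neutral[OF ballI])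
      then show False using False by simp
    qed
    then have AB: "0 < A" "0 < B" using False nn by auto
    define y where "y = ln (A / B)"
    have "rel_ent A B = A * y - B * (exp y - 1)"
      using AB by (simp add: rel_ent_def y_def field_simps)
    also have "\<dots> = (\<Sum>i\<in>I. k i * (a i * y - b i * (exp y - 1)))"
      by (simp add: A_def B_def right_diff_distrib sum_subtractf sum_distrib_right mult.assoc)
    also have "\<dots> \<le> (\<Sum>i\<in>I. k i * rel_ent (a i) (b i))"
      using k ab by (intro sum_mono mult_left_mono rel_ent_ge_tangent) auto
    finally show ?thesis by (simp add: A_def B_def)
  qed
qed

lemma rel_ent_mult: "0 \<le> c \<Longrightarrow> rel_ent (c * a) (c * b) = c * rel_ent a b"
  by (cases "c = 0") (simp_all add: rel_ent_def algebra_simps)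

lemma rel_ent_convex:
  assumes "0 \<le> c" "c \<le> 1" "0 \<le> a\<^sub>1" "0 \<le> b\<^sub>1" "b\<^sub>1 = 0 \<longrightarrow> a\<^sub>1 = 0" "0 \<le> a\<^sub>2" "0 \<le> b\<^sub>2" "b\<^sub>2 = 0 \<longrightarrow> a\<^sub>2 = 0"
  shows "rel_ent (c * a\<^sub>1 + (1 - c) * a\<^sub>2) (c * b\<^sub>1 + (1 - c) * b\<^sub>2)
    \<le> c * rel_ent a\<^sub>1 b\<^sub>1 + (1 - c) * rel_ent a\<^sub>2 b\<^sub>2"
  using rel_ent_sum_le[of UNIV "\<lambda>i. if i then c else 1 - c" "\<lambda>i. if i then a\<^sub>1 else a\<^sub>2"
      "\<lambda>i. if i then b\<^sub>1 else b\<^sub>2"] assms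
  by (simp add: UNIV_bool add.commute)

section \<open>Kullback--Leibler divergence and densities\<close>

text \<open>
  The Radon--Nikodym derivative in the definition of \<open>KL\<close> may be replaced by any given density.
\<close>

lemma KL_density_eq:
  fixes g :: "'b \<Rightarrow> real"
  assumes "prob_space \<nu>" and g: "g \<in> borel_measurable \<nu>" and nn: "\<And>s. 0 \<le> g s"
    and int: "integrable \<nu> (\<lambda>s. g s * ln (g s))"
  shows "KL (density \<nu> g) \<nu> = ereal (\<integral>s. g s * ln (g s) \<partial>\<nu>)"
proof -
  interpret prob_space \<nu> by fact
  let ?\<mu> = "density \<nu> g"
  have ac: "absolutely_continuous \<nu> ?\<mu>"
    using g by (intro absolutely_continuousI_density) simp
  have "density \<nu> (RN_deriv \<nu> ?\<mu>) = ?\<mu>"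
    using g by (intro density_RN_deriv_density) simp
  then have "AE s in \<nu>. RN_deriv \<nu> ?\<mu> s = ennreal (g s)"
    using g by (intro density_unique) auto
  then have eq: "AE s in \<nu>. g s * entropy_density (exp 1) \<nu> ?\<mu> s = g s * ln (g s)"
    by eventually_elim (simp add: entropy_density_def nn log_def)
  note m = measurable_entropy_density[of "exp 1" \<nu> ?\<mu>]
  have "integrable \<nu> (\<lambda>s. g s * entropy_density (exp 1) \<nu> ?\<mu> s)"
    using g m by (intro integrable_cong_AE[THEN iffD2, OF _ _ eq int]) auto
  then have "integrable ?\<mu> (entropy_density (exp 1) \<nu> ?\<mu>)"
    using g m by (subst integrable_real_density) (auto simp: nn)
  moreover have "KL_divergence (exp 1) \<nu> ?\<mu> = (\<integral>s. g s * ln (g s) \<partial>\<nu>)"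
    using g by (subst KL_density) (auto simp: nn log_def)
  ultimately show ?thesis using ac by (simp add: KL_def)
qed

lemma real_densityE:
  assumes "prob_space \<nu>" "prob_space \<mu>" and ac: "absolutely_continuous \<nu> \<mu>" "sets \<mu> = sets \<nu>"
  obtains g :: "'b \<Rightarrow> real" where "g \<in> borel_measurable \<nu>" "\<And>s. 0 \<le> g s" "\<mu> = density \<nu> g"
proof -
  interpret N: prob_space \<nu> by fact
  interpret M: prob_space \<mu> by fact
  obtain D where D: "D \<in> borel_measurable \<nu>" "AE x in \<nu>. RN_deriv \<nu> \<mu> x = ennreal (D x)"
    "\<And>x. 0 \<le> D x"
    using N.real_RN_deriv[OF M.finite_measure_axioms ac] by blast
  have "\<mu> = density \<nu> (RN_deriv \<nu> \<mu>)" using N.density_RN_deriv[OF ac] by simp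
  also have "\<dots> = density \<nu> (\<lambda>x. ennreal (D x))" using D by (intro density_cong) auto
  finally show ?thesis using D that by blast
qed

lemma KL_finiteE:
  assumes \<nu>: "prob_space \<nu>" and \<mu>: "prob_space \<mu>" and s: "sets \<mu> = sets \<nu>" and fin: "KL \<mu> \<nu> < \<infinity>"
  obtains g :: "'b \<Rightarrow> real" where "g \<in> borel_measurable \<nu>" "\<And>s. 0 \<le> g s" "\<mu> = density \<nu> g"
    "integrable \<nu> (\<lambda>s. g s * ln (g s))" "KL \<mu> \<nu> = ereal (\<integral>s. g s * ln (g s) \<partial>\<nu>)"
proof -
  interpret prob_space \<nu> by fact
  have ac: "absolutely_continuous \<nu> \<mu>" and int: "integrable \<mu> (entropy_density (exp 1) \<nu> \<mu>)"
    using fin by (auto simp: KL_def split: if_splits)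
  obtain g :: "_ \<Rightarrow> real" where g: "g \<in> borel_measurable \<nu>" "\<And>s. 0 \<le> g s" "\<mu> = density \<nu> g"
    using real_densityE[OF \<nu> \<mu> ac s] by blast
  have "density \<nu> (RN_deriv \<nu> \<mu>) = density \<nu> g"
    using g(1) unfolding g(3) by (intro density_RN_deriv_density) simp
  then have "AE s in \<nu>. RN_deriv \<nu> \<mu> s = ennreal (g s)"
    using g by (intro density_unique) auto
  then have eq: "AE s in \<nu>. g s * ln (g s) = g s * entropy_density (exp 1) \<nu> \<mu> s"
    by eventually_elim (simp add: entropy_density_def g(2) log_def)
  note m = measurable_entropy_density[of "exp 1" \<nu> \<mu>]
  have "integrable \<nu> (\<lambda>s. g s * entropy_density (exp 1) \<nu> \<mu> s)"
    using int m g by (subst integrable_real_density[symmetric]) auto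
  then have "integrable \<nu> (\<lambda>s. g s * ln (g s))"
    using g m by (intro integrable_cong_AE[THEN iffD2, OF _ _ eq]) auto
  then show ?thesis using that g KL_density_eq[OF \<nu> g(1,2)] by auto
qed

section \<open>Laws observed through a kernel\<close>

locale observation_kernel =
  fixes Obs :: "'a::finite \<Rightarrow> 'b::metric_space measure"
  assumes Obs: "Obs \<in> measurable (count_space UNIV) (prob_algebra borel)"
begin

lemma prob_space_Obs: "prob_space (Obs \<xi>)" and sets_Obs[simp, measurable_cong]: "sets (Obs \<xi>) = sets borel"
  and space_Obs[simp]: "space (Obs \<xi>) = UNIV"
proof -
  have *: "Obs \<xi> \<in> space (prob_algebra borel)" using measurable_space[OF Obs, of \<xi>] by simp
  then show "prob_space (Obs \<xi>)" "sets (Obs \<xi>) = sets borel" by (auto simp: space_prob_algebra)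
  then show "space (Obs \<xi>) = UNIV" using sets_eq_imp_space_eq[of "Obs \<xi>" borel] by simp
qed

lemma measurable_Obs_subprob: "Obs \<in> measurable (measure_pmf Q) (subprob_algebra borel)"
  using measurable_prob_algebraD[OF Obs] by (simp add: measurable_def)

lemma prob_space_observed_law: "prob_space (observed_law Obs Q)"
  and sets_observed_law[simp, measurable_cong]: "sets (observed_law Obs Q) = sets borel"
  and space_observed_law[simp]: "space (observed_law Obs Q) = UNIV"
proof -
  show "prob_space (observed_law Obs Q)"
    unfolding observed_law_def
    by (intro measure_pmf.prob_space_bind[OF _ measurable_Obs_subprob]) (simp add: prob_space_Obs)
  show "sets (observed_law Obs Q) = sets borel"
    unfolding observed_law_def by (rule sets_bind[where N = borel]) auto
  from sets_eq_imp_space_eq[OF this] show "space (observed_law Obs Q) = UNIV" by simp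
qed

lemma nn_integral_observed_law:
  assumes "f \<in> borel_measurable borel"
  shows "(\<integral>\<^sup>+s. f s \<partial>observed_law Obs Q) = (\<Sum>\<xi>\<in>UNIV. ennreal (pmf Q \<xi>) * (\<integral>\<^sup>+s. f s \<partial>Obs \<xi>))"
  unfolding observed_law_def nn_integral_bind[OF assms measurable_Obs_subprob]
  by (simp add: nn_integral_measure_pmf nn_integral_count_space_finite)

text \<open>
  The factor \<open>pmf Q \<xi>\<close> stays inside the integral because \<open>h\<close> need not be integrable with respect to
  \<open>Obs \<xi>\<close> if \<open>pmf Q \<xi> = 0\<close>.
\<close>

lemma integral_observed_law:
  fixes h :: "'b \<Rightarrow> real"
  assumes h: "integrable (observed_law Obs Q) h"
  shows "integrable (Obs \<xi>) (\<lambda>s. pmf Q \<xi> * h s)"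
    and "(\<integral>s. h s \<partial>observed_law Obs Q) = (\<Sum>\<xi>\<in>UNIV. \<integral>s. pmf Q \<xi> * h s \<partial>Obs \<xi>)"
proof -
  have [measurable]: "h \<in> borel_measurable borel"
    using borel_measurable_integrable[OF h] by simp
  have fin: "ennreal (pmf Q \<xi>) * (\<integral>\<^sup>+s. ennreal (norm (h s)) \<partial>Obs \<xi>) < \<infinity>" for \<xi>
  proof -
    have "ennreal (pmf Q \<xi>) * (\<integral>\<^sup>+s. ennreal (norm (h s)) \<partial>Obs \<xi>)
        \<le> (\<Sum>\<xi>\<in>UNIV. ennreal (pmf Q \<xi>) * (\<integral>\<^sup>+s. ennreal (norm (h s)) \<partial>Obs \<xi>))"
      by (intro member_le_sum) auto
    also have "\<dots> = (\<integral>\<^sup>+s. ennreal (norm (h s)) \<partial>observed_law Obs Q)"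
      by (rule nn_integral_observed_law[symmetric]) measurable
    also have "\<dots> < \<infinity>" using h by (simp add: integrable_iff_bounded)
    finally show ?thesis .
  qed
  show int: "integrable (Obs \<xi>) (\<lambda>s. pmf Q \<xi> * h s)" for \<xi>
  proof (rule integrableI_bounded)
    have "(\<integral>\<^sup>+s. ennreal (norm (pmf Q \<xi> * h s)) \<partial>Obs \<xi>)
        = ennreal (pmf Q \<xi>) * (\<integral>\<^sup>+s. ennreal (norm (h s)) \<partial>Obs \<xi>)"
      by (simp add: abs_mult ennreal_mult nn_integral_cmult)
    then show "(\<integral>\<^sup>+s. ennreal (norm (pmf Q \<xi> * h s)) \<partial>Obs \<xi>) < \<infinity>"
      using fin[of \<xi>] by (simp only:)
  qed measurable
  have nn: "(\<integral>\<^sup>+s. ennreal (c * h s) \<partial>observed_law Obs Q)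
      = (\<Sum>\<xi>\<in>UNIV. \<integral>\<^sup>+s. ennreal (c * (pmf Q \<xi> * h s)) \<partial>Obs \<xi>)" for c
    by (subst nn_integral_observed_law)
      (auto simp: nn_integral_cmult[symmetric] ennreal_mult'[symmetric] ac_simps
        intro!: sum.cong nn_integral_cong)
  have fin': "(\<integral>\<^sup>+s. ennreal (c * (pmf Q \<xi> * h s)) \<partial>Obs \<xi>) < \<infinity>" for c \<xi>
    using real_integrable_def[THEN iffD1, OF integrable_mult_right[OF int[of \<xi>], of c]]
    by (auto simp: less_top)
  have e: "enn2real (\<Sum>\<xi>\<in>UNIV. \<integral>\<^sup>+s. ennreal (c * (pmf Q \<xi> * h s)) \<partial>Obs \<xi>)
    = (\<Sum>\<xi>\<in>UNIV. enn2real (\<integral>\<^sup>+s. ennreal (c * (pmf Q \<xi> * h s)) \<partial>Obs \<xi>))" for c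
    using fin' by (subst enn2real_sum) (simp_all add: comp_def)
  have "(\<integral>s. h s \<partial>observed_law Obs Q) =
      enn2real (\<integral>\<^sup>+s. ennreal (1 * h s) \<partial>observed_law Obs Q)
      - enn2real (\<integral>\<^sup>+s. ennreal ((-1) * h s) \<partial>observed_law Obs Q)"
    using real_lebesgue_integral_def[OF h] by simp
  also have "\<dots> = (\<Sum>\<xi>\<in>UNIV. enn2real (\<integral>\<^sup>+s. ennreal (1 * (pmf Q \<xi> * h s)) \<partial>Obs \<xi>)
      - enn2real (\<integral>\<^sup>+s. ennreal ((-1) * (pmf Q \<xi> * h s)) \<partial>Obs \<xi>))"
    unfolding nn e by (simp add: sum_subtractf)
  also have "\<dots> = (\<Sum>\<xi>\<in>UNIV. \<integral>s. pmf Q \<xi> * h s \<partial>Obs \<xi>)"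
    by (intro sum.cong refl) (simp add: real_lebesgue_integral_def[OF int] del: integral_mult_right_zero)
  finally show "(\<integral>s. h s \<partial>observed_law Obs Q) = (\<Sum>\<xi>\<in>UNIV. \<integral>s. pmf Q \<xi> * h s \<partial>Obs \<xi>)" .
qed

lemma absolutely_continuous_observed_law:
  assumes "0 < pmf Q \<xi>"
  shows "absolutely_continuous (observed_law Obs Q) (Obs \<xi>)"
  unfolding absolutely_continuous_def
proof
  fix B assume B: "B \<in> null_sets (observed_law Obs Q)"
  then have [measurable]: "B \<in> sets borel" by (auto simp: null_sets_def)
  have "0 = (\<integral>\<^sup>+s. indicator B s \<partial>observed_law Obs Q)" using B by (simp add: null_sets_def)
  also have "\<dots> = (\<Sum>\<xi>\<in>UNIV. ennreal (pmf Q \<xi>) * emeasure (Obs \<xi>) B)"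
    by (subst nn_integral_observed_law) auto
  finally have "ennreal (pmf Q \<xi>) * emeasure (Obs \<xi>) B = 0"
    using sum_eq_0_iff[of UNIV "\<lambda>\<xi>. ennreal (pmf Q \<xi>) * emeasure (Obs \<xi>) B"] by simp
  then show "B \<in> null_sets (Obs \<xi>)" using assms by (auto simp: null_sets_def ennreal_eq_0_iff not_le)
qed

text \<open>
  The weighted sum of the densities is a density of \<open>observed_law Obs Q\<close> with respect to itself,
  hence \<open>1\<close> almost everywhere. The value of \<open>k \<xi>\<close> is arbitrary if \<open>pmf Q \<xi> = 0\<close>.
\<close>

lemma kernel_densitiesE:
  obtains k :: "'a \<Rightarrow> 'b \<Rightarrow> real"
  where "\<And>\<xi>. k \<xi> \<in> borel_measurable borel" "\<And>\<xi> s. 0 \<le> k \<xi> s"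
    "\<And>\<xi>. 0 < pmf Q \<xi> \<Longrightarrow> Obs \<xi> = density (observed_law Obs Q) (k \<xi>)"
    "AE s in observed_law Obs Q. (\<Sum>\<xi>\<in>UNIV. k \<xi> s * pmf Q \<xi>) = 1"
proof -
  let ?q = "observed_law Obs Q"
  interpret q: prob_space ?q by (rule prob_space_observed_law)
  have "\<exists>k. k \<in> borel_measurable borel \<and> (\<forall>s. 0 \<le> k s) \<and>
      (0 < pmf Q \<xi> \<longrightarrow> Obs \<xi> = density ?q (\<lambda>s. ennreal (k s :: real)))" for \<xi>
  proof (cases "0 < pmf Q \<xi>")
    case True
    obtain g where "g \<in> borel_measurable ?q" "\<And>s. 0 \<le> g s" "Obs \<xi> = density ?q (\<lambda>s. ennreal (g s :: real))"
      using real_densityE[OF prob_space_observed_law prob_space_Obs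
          absolutely_continuous_observed_law[OF True]] by auto
    then show ?thesis by (intro exI[of _ g]) auto
  qed (auto intro!: exI[of _ "\<lambda>_. 0"])
  then obtain k where k: "\<And>\<xi>. k \<xi> \<in> borel_measurable borel" "\<And>\<xi> s. 0 \<le> k \<xi> s"
    "\<And>\<xi>. 0 < pmf Q \<xi> \<Longrightarrow> Obs \<xi> = density ?q (\<lambda>s. ennreal (k \<xi> s :: real))" by metis
  note [measurable] = k(1)
  have "density ?q (\<lambda>s. ennreal (\<Sum>\<xi>\<in>UNIV. k \<xi> s * pmf Q \<xi>)) = density ?q (\<lambda>_. 1)"
  proof (rule measure_eqI)
    fix B assume "B \<in> sets (density ?q (\<lambda>s. ennreal (\<Sum>\<xi>\<in>UNIV. k \<xi> s * pmf Q \<xi>)))"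
    then have [measurable]: "B \<in> sets borel" by simp
    have "emeasure (density ?q (\<lambda>s. ennreal (\<Sum>\<xi>\<in>UNIV. k \<xi> s * pmf Q \<xi>))) B
      = (\<integral>\<^sup>+s. (\<Sum>\<xi>\<in>UNIV. ennreal (pmf Q \<xi>) * (ennreal (k \<xi> s) * indicator B s)) \<partial>?q)"
      by (subst emeasure_density)
        (auto simp: sum_ennreal[symmetric] k sum_distrib_right ennreal_mult ac_simps
          intro!: nn_integral_cong sum.cong)
    also have "\<dots> = (\<Sum>\<xi>\<in>UNIV. ennreal (pmf Q \<xi>) * (\<integral>\<^sup>+s. ennreal (k \<xi> s) * indicator B s \<partial>?q))"
      by (simp add: nn_integral_sum nn_integral_cmult)
    also have "\<dots> = (\<Sum>\<xi>\<in>UNIV. ennreal (pmf Q \<xi>) * emeasure (Obs \<xi>) B)"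
    proof (intro sum.cong refl)
      fix \<xi>
      show "ennreal (pmf Q \<xi>) * (\<integral>\<^sup>+s. ennreal (k \<xi> s) * indicator B s \<partial>?q)
          = ennreal (pmf Q \<xi>) * emeasure (Obs \<xi>) B"
      proof (cases "0 < pmf Q \<xi>")
        case True
        have "emeasure (Obs \<xi>) B = emeasure (density ?q (k \<xi>)) B" using k(3)[OF True] by simp
        also have "\<dots> = (\<integral>\<^sup>+s. ennreal (k \<xi> s) * indicator B s \<partial>?q)"
          by (subst emeasure_density) auto
        finally show ?thesis by simp
      next
        case False then show ?thesis by (simp add: not_less)
      qed
    qed
    also have "\<dots> = emeasure (density ?q (\<lambda>_. 1)) B"
      using nn_integral_observed_law[of "indicator B" Q] by (simp add: density_1)
    finally show "emeasure (density ?q (\<lambda>s. ennreal (\<Sum>\<xi>\<in>UNIV. k \<xi> s * pmf Q \<xi>))) B =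
        emeasure (density ?q (\<lambda>_. 1)) B" .
  qed simp
  then have "AE s in ?q. ennreal (\<Sum>\<xi>\<in>UNIV. k \<xi> s * pmf Q \<xi>) = 1"
    by (intro q.density_unique) auto
  then have "AE s in ?q. (\<Sum>\<xi>\<in>UNIV. k \<xi> s * pmf Q \<xi>) = 1"
    by eventually_elim (simp only: ennreal_eq_1)
  with k that show ?thesis by blast
qed

text \<open>
  The measure with parts \<open>\<rho> \<xi>\<close> is the observation marginal of a joint law of \<open>\<xi>\<close> and the observation, and
  \<open>observed_law Obs Q\<close> is that of the joint law given by \<open>Q\<close> and \<open>Obs\<close>. Passing to marginals does not
  increase the divergence: rewrite all parts as densities with respect to \<open>observed_law Obs Q\<close> and use
  that \<open>rel_ent\<close> is sublinear.
\<close>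

lemma rate_mixture_le:
  fixes \<rho> :: "'a \<Rightarrow> 'b \<Rightarrow> real"
  assumes \<rho>[measurable]: "\<And>\<xi>. \<rho> \<xi> \<in> borel_measurable borel" and nn: "\<And>\<xi> s. 0 \<le> \<rho> \<xi> s"
    and z: "\<And>\<xi> s. pmf Q \<xi> = 0 \<Longrightarrow> \<rho> \<xi> s = 0"
    and int: "\<And>\<xi>. integrable (Obs \<xi>) (\<rho> \<xi>)"
    and ient: "\<And>\<xi>. integrable (Obs \<xi>) (\<lambda>s. rel_ent (\<rho> \<xi> s) (pmf Q \<xi>))"
    and mass: "(\<Sum>\<xi>\<in>UNIV. \<integral>s. \<rho> \<xi> s \<partial>Obs \<xi>) = 1"
  obtains p where "p \<in> space (prob_algebra borel)"
    "\<And>B. B \<in> sets borel \<Longrightarrow> measure p B = (\<Sum>\<xi>\<in>UNIV. \<integral>s. \<rho> \<xi> s * indicator B s \<partial>Obs \<xi>)"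
    "rate Obs p Q \<le> ereal (\<Sum>\<xi>\<in>UNIV. \<integral>s. rel_ent (\<rho> \<xi> s) (pmf Q \<xi>) \<partial>Obs \<xi>)"
proof -
  let ?q = "observed_law Obs Q"
  interpret q: prob_space ?q by (rule prob_space_observed_law)
  obtain k :: "'a \<Rightarrow> 'b \<Rightarrow> real" where k[measurable]: "\<And>\<xi>. k \<xi> \<in> borel_measurable borel"
    and knn: "\<And>\<xi> s. 0 \<le> k \<xi> s"
    and kd: "\<And>\<xi>. 0 < pmf Q \<xi> \<Longrightarrow> Obs \<xi> = density ?q (k \<xi>)"
    and k1: "AE s in ?q. (\<Sum>\<xi>\<in>UNIV. k \<xi> s * pmf Q \<xi>) = 1"
    using kernel_densitiesE[of Q] by blast
  have tr: "integrable ?q (\<lambda>s. k \<xi> s * h s) \<and> (\<integral>s. k \<xi> s * h s \<partial>?q) = (\<integral>s. h s \<partial>Obs \<xi>)"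
    if [measurable]: "h \<in> borel_measurable borel" and "integrable (Obs \<xi>) h"
      and "pmf Q \<xi> = 0 \<Longrightarrow> h = (\<lambda>_. 0)" for \<xi> and h :: "'b \<Rightarrow> real"
  proof (cases "0 < pmf Q \<xi>")
    case True
    have "integrable (density ?q (k \<xi>)) h" using that(2) kd[OF True] by simp
    moreover have "(\<integral>s. h s \<partial>density ?q (k \<xi>)) = (\<integral>s. h s \<partial>Obs \<xi>)" using kd[OF True] by simp
    ultimately show ?thesis
      using knn by (simp add: integrable_real_density integral_real_density)
  next
    case False
    then have "pmf Q \<xi> = 0" using pmf_nonneg[of Q \<xi>] by linarith
    then show ?thesis using that(3) by simp
  qed
  define g where "g s = (\<Sum>\<xi>\<in>UNIV. k \<xi> s * \<rho> \<xi> s)" for s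
  define c where "c s = (\<Sum>\<xi>\<in>UNIV. k \<xi> s * rel_ent (\<rho> \<xi> s) (pmf Q \<xi>))" for s
  have g[measurable]: "g \<in> borel_measurable borel" unfolding g_def by measurable
  have gnn: "0 \<le> g s" for s unfolding g_def by (intro sum_nonneg mult_nonneg_nonneg knn nn)
  have tr\<rho>: "integrable ?q (\<lambda>s. k \<xi> s * \<rho> \<xi> s)" "(\<integral>s. k \<xi> s * \<rho> \<xi> s \<partial>?q) = (\<integral>s. \<rho> \<xi> s \<partial>Obs \<xi>)" for \<xi>
    using tr[of "\<rho> \<xi>" \<xi>] int[of \<xi>] z[of \<xi>] by auto
  have tre: "integrable ?q (\<lambda>s. k \<xi> s * rel_ent (\<rho> \<xi> s) (pmf Q \<xi>))"
     "(\<integral>s. k \<xi> s * rel_ent (\<rho> \<xi> s) (pmf Q \<xi>) \<partial>?q) = (\<integral>s. rel_ent (\<rho> \<xi> s) (pmf Q \<xi>) \<partial>Obs \<xi>)" for \<xi>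
    using tr[of "\<lambda>s. rel_ent (\<rho> \<xi> s) (pmf Q \<xi>)" \<xi>] ient[of \<xi>] z[of \<xi>] by (auto simp: rel_ent_def)
  have gi: "integrable ?q g" unfolding g_def using tr\<rho> by auto
  have g1: "(\<integral>s. g s \<partial>?q) = 1" unfolding g_def using mass tr\<rho> by (subst Bochner_Integration.integral_sum) auto
  have ci: "integrable ?q c" unfolding c_def using tre by auto
  have c: "(\<integral>s. c s \<partial>?q) = (\<Sum>\<xi>\<in>UNIV. \<integral>s. rel_ent (\<rho> \<xi> s) (pmf Q \<xi>) \<partial>Obs \<xi>)"
    unfolding c_def using tre by (subst Bochner_Integration.integral_sum) auto
  have le: "AE s in ?q. rel_ent (g s) 1 \<le> c s"
    using k1
  proof eventually_elim
    fix s assume 1: "(\<Sum>\<xi>\<in>UNIV. k \<xi> s * pmf Q \<xi>) = 1"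
    have "rel_ent (\<Sum>\<xi>\<in>UNIV. k \<xi> s * \<rho> \<xi> s) (\<Sum>\<xi>\<in>UNIV. k \<xi> s * pmf Q \<xi>) \<le> c s"
      unfolding c_def by (rule rel_ent_sum_le) (auto simp: knn nn z)
    then show "rel_ent (g s) 1 \<le> c s" by (simp add: 1 g_def)
  qed
  have ri: "integrable ?q (\<lambda>s. rel_ent (g s) 1)"
  proof (rule Bochner_Integration.integrable_bound[OF ci])
    show "AE s in ?q. norm (rel_ent (g s) 1) \<le> norm (c s)"
      using le
    proof eventually_elim
      case (elim s)
      then show ?case using rel_ent_nonneg[of "g s" 1] gnn[of s] by simp
    qed
  qed measurable
  have eq: "g s * ln (g s) = rel_ent (g s) 1 + g s - 1" for s by (simp add: rel_ent_def)
  have li: "integrable ?q (\<lambda>s. g s * ln (g s))" unfolding eq using ri gi by auto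
  have "(\<integral>s. g s * ln (g s) \<partial>?q) = (\<integral>s. rel_ent (g s) 1 \<partial>?q)"
    unfolding eq using ri gi g1 q.prob_space by simp
  also have "\<dots> \<le> (\<integral>s. c s \<partial>?q)" using le ri ci by (intro integral_mono_AE) auto
  finally have KLle: "KL (density ?q g) ?q \<le> ereal (\<integral>s. c s \<partial>?q)"
    using KL_density_eq[OF prob_space_observed_law _ gnn li] by simp
  show ?thesis
  proof
    have em: "emeasure (density ?q g) B = ennreal (\<Sum>\<xi>\<in>UNIV. \<integral>s. \<rho> \<xi> s * indicator B s \<partial>Obs \<xi>)"
      if [measurable]: "B \<in> sets borel" for B
    proof -
      have i: "integrable (Obs \<xi>) (\<lambda>s. \<rho> \<xi> s * indicator B s)" for \<xi>
        using int[of \<xi>] by (intro integrable_real_mult_indicator) auto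
      have t: "integrable ?q (\<lambda>s. k \<xi> s * (\<rho> \<xi> s * indicator B s))"
          "(\<integral>s. k \<xi> s * (\<rho> \<xi> s * indicator B s) \<partial>?q) = (\<integral>s. \<rho> \<xi> s * indicator B s \<partial>Obs \<xi>)" for \<xi>
        using tr[of "\<lambda>s. \<rho> \<xi> s * indicator B s" \<xi>] i[of \<xi>] z[of \<xi>] by auto
      have gB: "integrable ?q (\<lambda>s. g s * indicator B s)"
        using gi by (intro integrable_real_mult_indicator) auto
      have "emeasure (density ?q g) B = (\<integral>\<^sup>+s. ennreal (g s * indicator B s) \<partial>?q)"
        by (subst emeasure_density) (auto intro!: nn_integral_cong split: split_indicator)
      also have "\<dots> = ennreal (\<integral>s. g s * indicator B s \<partial>?q)"
        using gB by (intro nn_integral_eq_integral) (auto simp: gnn)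
      also have "(\<integral>s. g s * indicator B s \<partial>?q) = (\<integral>s. (\<Sum>\<xi>\<in>UNIV. k \<xi> s * (\<rho> \<xi> s * indicator B s)) \<partial>?q)"
        by (simp add: g_def sum_distrib_right mult.assoc)
      also have "\<dots> = (\<Sum>\<xi>\<in>UNIV. \<integral>s. \<rho> \<xi> s * indicator B s \<partial>Obs \<xi>)"
        using t by (subst Bochner_Integration.integral_sum) auto
      finally show ?thesis .
    qed
    have nnB: "0 \<le> (\<Sum>\<xi>\<in>UNIV. \<integral>s. \<rho> \<xi> s * indicator B s \<partial>Obs \<xi>)" for B
      by (intro sum_nonneg integral_nonneg_AE) (simp add: nn)
    show "measure (density ?q g) B = (\<Sum>\<xi>\<in>UNIV. \<integral>s. \<rho> \<xi> s * indicator B s \<partial>Obs \<xi>)"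
      if "B \<in> sets borel" for B
      using em[OF that] nnB[of B] by (simp add: measure_def)
    show "density ?q g \<in> space (prob_algebra borel)"
      using em[of UNIV] mass by (auto simp: space_prob_algebra intro!: prob_spaceI)
    show "rate Obs (density ?q g) Q \<le> ereal (\<Sum>\<xi>\<in>UNIV. \<integral>s. rel_ent (\<rho> \<xi> s) (pmf Q \<xi>) \<partial>Obs \<xi>)"
      using KLle by (simp add: rate_def c)
  qed
qed

end

section \<open>The Levy--Prokhorov ball around an empirical measure\<close>

context
  fixes x :: "nat \<Rightarrow> 'b::metric_space" and N :: nat
  assumes N: "1 \<le> N"
begin

lemma finite_supp_empirical: "finite (supp (empirical N x))"
  and supp_empirical_nonempty: "supp (empirical N x) \<noteq> {}"
  using N by (simp_all add: supp_empirical)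

lemma measure_empirical_Int_supp:
  assumes B: "B \<in> sets borel"
  shows "measure (empirical N x) (B \<inter> supp (empirical N x)) = measure (empirical N x) B"
proof -
  have [measurable]: "supp (empirical N x) \<in> sets borel"
    by (intro borel_closed finite_imp_closed finite_supp_empirical)
  have Bs: "B \<inter> supp (empirical N x) \<in> sets borel" using B by measurable
  have x: "x i \<in> supp (empirical N x)" if "i \<in> {1..N}" for i
    using N that by (simp add: supp_empirical)
  have "emeasure (return borel (x i)) (B \<inter> supp (empirical N x)) = emeasure (return borel (x i)) B"
    if "i \<in> {1..N}" for i
    using x[OF that] B Bs by (simp add: indicator_def)
  then have "emeasure (empirical N x) (B \<inter> supp (empirical N x)) = emeasure (empirical N x) B"
    using N by (simp only: emeasure_empirical[OF N B] emeasure_empirical[OF N Bs] cong: sum.cong)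
  then show ?thesis by (simp add: measure_def)
qed

lemma measure_empirical_subset_supp:
  assumes "F \<subseteq> supp (empirical N x)"
  shows "measure (empirical N x) F = (\<Sum>y\<in>F. measure (empirical N x) {y})"
proof -
  interpret prob_space "empirical N x"
    using prob_space_empirical[OF N, of x] by (simp add: space_prob_algebra)
  have s: "sets (empirical N x) = sets borel"
    using prob_space_empirical[OF N, of x] by (simp add: space_prob_algebra)
  show ?thesis
    using finite_subset[OF assms finite_supp_empirical]
    by (intro finite_measure_eq_sum_singleton) (auto simp: s)
qed

lemma sum_weights_empirical: "(\<Sum>y\<in>supp (empirical N x). measure (empirical N x) {y}) = 1"
proof -
  interpret prob_space "empirical N x"
    using prob_space_empirical[OF N, of x] by (simp add: space_prob_algebra)
  have "space (empirical N x) = UNIV"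
    using prob_space_empirical[OF N, of x] by (auto simp: space_prob_algebra dest: sets_eq_imp_space_eq)
  then have "measure (empirical N x) UNIV = 1" using prob_space by simp
  then show ?thesis
    using measure_empirical_Int_supp[of UNIV] measure_empirical_subset_supp[OF order_refl] by simp
qed

lemma set_integral_empirical_supp:
  fixes v :: "'b \<Rightarrow> real"
  shows "(LINT s:supp (empirical N x)|empirical N x. v s)
    = (\<Sum>y\<in>supp (empirical N x). measure (empirical N x) {y} * v y)"
proof -
  interpret prob_space "empirical N x"
    using prob_space_empirical[OF N, of x] by (simp add: space_prob_algebra)
  have s[simp]: "sets (empirical N x) = sets borel"
    using prob_space_empirical[OF N, of x] by (simp add: space_prob_algebra)
  have "(LINT s:supp (empirical N x)|empirical N x. v s)
      = (\<integral>s. (\<Sum>y\<in>supp (empirical N x). indicator {y} s * v y) \<partial>empirical N x)"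
    unfolding set_lebesgue_integral_def
  proof (intro Bochner_Integration.integral_cong refl)
    fix s
    show "indicator (supp (empirical N x)) s *\<^sub>R v s
        = (\<Sum>y\<in>supp (empirical N x). indicator {y} s * v y)"
      using finite_supp_empirical by (auto simp: indicator_def sum.delta if_distrib cong: if_cong)
  qed
  also have "\<dots> = (\<Sum>y\<in>supp (empirical N x). \<integral>s. indicator {y} s * v y \<partial>empirical N x)"
  proof (intro Bochner_Integration.integral_sum)
    fix y
    have "integrable (empirical N x) (indicat_real {y})"
      by (intro integrable_real_indicator) (auto simp: emeasure_eq_measure)
    then show "integrable (empirical N x) (\<lambda>s. indicator {y} s * v y)" by (rule integrable_mult_left)
  qed
  also have "\<dots> = (\<Sum>y\<in>supp (empirical N x). measure (empirical N x) {y} * v y)"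
    by (simp add: sets_eq_imp_space_eq[OF s])
  finally show ?thesis .
qed

text \<open>
  A Borel set has the same empirical mass as its intersection with the support, and the latter has
  the smaller enlargement. So the Levy--Prokhorov ball around an empirical measure is cut out by finitely
  many linear constraints.
\<close>

lemma levy_prokhorov_empirical_le_iff_finite:
  assumes \<mu>: "\<mu> \<in> space (prob_algebra borel)" and \<delta>: "0 \<le> \<delta>"
  shows "levy_prokhorov \<mu> (empirical N x) \<le> \<delta> \<longleftrightarrow>
    (\<forall>F\<subseteq>supp (empirical N x). measure (empirical N x) F \<le> measure \<mu> (\<Union>y\<in>F. cball y \<delta>) + \<delta>)"
proof -
  let ?P = "empirical N x"
  interpret M: prob_space \<mu> using \<mu> by (simp add: space_prob_algebra)
  interpret P: prob_space ?P using prob_space_empirical[OF N, of x] by (simp add: space_prob_algebra)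
  have s: "sets \<mu> = sets borel" using \<mu> by (auto simp: space_prob_algebra)
  have e: "{s'. \<exists>s\<in>B. dist s s' \<le> \<delta>} = (\<Union>y\<in>B. cball y \<delta>)" for B :: "'b set" by auto
  have F: "finite F" "F \<in> sets borel" "(\<Union>y\<in>F. cball y \<delta>) \<in> sets \<mu>" if "F \<subseteq> supp ?P" for F
  proof -
    show "finite F" using that finite_supp_empirical finite_subset by blast
    then show "F \<in> sets borel" by (intro borel_closed finite_imp_closed)
    show "(\<Union>y\<in>F. cball y \<delta>) \<in> sets \<mu>"
      unfolding s using \<open>finite F\<close> by (intro borel_closed closed_UN) auto
  qed
  have o: "emeasure ?P F \<le> outer_measure_of \<mu> (\<Union>y\<in>F. cball y \<delta>) + ennreal \<delta> \<longleftrightarrow>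
      measure ?P F \<le> measure \<mu> (\<Union>y\<in>F. cball y \<delta>) + \<delta>" if "F \<subseteq> supp ?P" for F
  proof -
    have "outer_measure_of \<mu> (\<Union>y\<in>F. cball y \<delta>) + ennreal \<delta>
        = ennreal (measure \<mu> (\<Union>y\<in>F. cball y \<delta>) + \<delta>)"
      using F[OF that] \<delta> by (simp add: outer_measure_of_eq M.emeasure_eq_measure)
    then show ?thesis using \<delta> by (simp add: P.emeasure_eq_measure del: ennreal_plus)
  qed
  show ?thesis
    unfolding levy_prokhorov_empirical_le_iff[OF \<mu> N \<delta>] e
  proof (intro iffI allI impI ballI)
    fix F assume "\<forall>B\<in>sets borel. emeasure ?P B \<le> outer_measure_of \<mu> (\<Union>y\<in>B. cball y \<delta>) + ennreal \<delta>"
      and "F \<subseteq> supp ?P"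
    then show "measure ?P F \<le> measure \<mu> (\<Union>y\<in>F. cball y \<delta>) + \<delta>" using F(2)[of F] o[of F] by simp
  next
    fix B :: "'b set"
    assume h: "\<forall>F\<subseteq>supp ?P. measure ?P F \<le> measure \<mu> (\<Union>y\<in>F. cball y \<delta>) + \<delta>"
      and B: "B \<in> sets borel"
    have "emeasure ?P B = emeasure ?P (B \<inter> supp ?P)"
      using measure_empirical_Int_supp[OF B] by (simp add: P.emeasure_eq_measure)
    also have "\<dots> \<le> outer_measure_of \<mu> (\<Union>y\<in>B \<inter> supp ?P. cball y \<delta>) + ennreal \<delta>"
      using h o[of "B \<inter> supp ?P"] by simp
    also have "\<dots> \<le> outer_measure_of \<mu> (\<Union>y\<in>B. cball y \<delta>) + ennreal \<delta>"
      by (intro add_mono outer_measure_of_mono) auto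
    finally show "emeasure ?P B \<le> outer_measure_of \<mu> (\<Union>y\<in>B. cball y \<delta>) + ennreal \<delta>" .
  qed
qed

end

text \<open>
  Here \<open>w\<close> are the atoms of an empirical measure and \<open>cover\<close> says that \<open>\<mu>\<close> has Levy--Prokhorov distance
  at most \<open>\<delta>\<close> from it; the conclusion is weak duality for transport with cost \<open>0\<close> or \<open>1\<close>. It comes from the
  layer-cake formula. After subtracting \<open>M = Max v\<close>, the function \<open>u\<close> dominates at \<open>s\<close> every
  \<open>h y = v y + \<gamma> - M\<close> with \<open>y\<close> within distance \<open>\<delta>\<close> of \<open>s\<close>. So the superlevel set of \<open>u - M\<close> at level \<open>t\<close>
  contains the enlargement of that of \<open>h\<close>, and its measure is at least the \<open>w\<close>-weight of
  the latter minus \<open>\<delta>\<close>. Integrating over \<open>t\<close> from \<open>0\<close> to \<open>\<gamma>\<close> gives the claim.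
\<close>

lemma transport_dual_le:
  fixes \<mu> :: "'b::metric_space measure" and u v w :: "'b \<Rightarrow> real"
  assumes \<mu>: "prob_space \<mu>" "sets \<mu> = sets borel"
    and S: "finite S" "S \<noteq> {}" and w: "\<And>y. y \<in> S \<Longrightarrow> 0 \<le> w y" "(\<Sum>y\<in>S. w y) = 1"
    and cover: "\<And>F. F \<subseteq> S \<Longrightarrow> (\<Sum>y\<in>F. w y) \<le> measure \<mu> (\<Union>y\<in>F. cball y \<delta>) + \<delta>"
    and \<delta>: "0 \<le> \<delta>" and \<gamma>: "0 \<le> \<gamma>" and u: "integrable \<mu> u"
    and feas: "\<And>s y. y \<in> S \<Longrightarrow> \<gamma> * of_bool (dist s y \<le> \<delta>) + v y \<le> u s"
  shows "(\<Sum>y\<in>S. w y * v y) + \<gamma> * (1 - \<delta>) \<le> (\<integral>s. u s \<partial>\<mu>)"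
proof -
  interpret prob_space \<mu> by fact
  interpret pair_sigma_finite \<mu> "lborel :: real measure" ..
  note [measurable_cong] = \<mu>(2)
  define M where "M = Max (v ` S)"
  have M: "\<And>y. y \<in> S \<Longrightarrow> v y \<le> M" using S by (simp add: M_def)
  have "M \<in> v ` S" unfolding M_def using S by (intro Max_in) auto
  then obtain y0 where y0: "y0 \<in> S" "M = v y0" by auto
  have uM: "M \<le> u s" for s
  proof -
    have "0 \<le> \<gamma> * of_bool (dist s y0 \<le> \<delta>)" using \<gamma> by simp
    then show ?thesis using feas[OF y0(1), of s] y0(2) by linarith
  qed
  define h where "h y = v y + \<gamma> - M" for y
  define D where "D = (UNIV \<times> {0..\<gamma>}) \<inter> (\<Union>y\<in>S. cball y \<delta> \<times> {..h y})"
  have D[measurable]: "D \<in> sets (\<mu> \<Otimes>\<^sub>M lborel)"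
  proof -
    have "UNIV \<in> sets \<mu>" "\<And>y. cball y \<delta> \<in> sets \<mu>" by (simp_all add: \<mu>(2))
    then show ?thesis
      unfolding D_def by (intro sets.Int sets.finite_UN pair_measureI S(1)) simp_all
  qed
  have "(\<Sum>y\<in>S. w y * h y) \<le> (\<Sum>y\<in>S. w y * max 0 (h y))"
    using w by (intro sum_mono mult_left_mono) auto
  moreover have "ennreal (\<Sum>y\<in>S. w y * max 0 (h y)) \<le> ennreal ((\<integral>s. (u s - M) \<partial>\<mu>) + \<gamma> * \<delta>)"
  proof -
    have "ennreal (\<Sum>y\<in>S. w y * max 0 (h y)) =
        (\<Sum>y\<in>S. ennreal (w y) * (\<integral>\<^sup>+t. indicator {0..h y} t \<partial>lborel))"
      using w by (subst sum_ennreal[symmetric]) (auto simp: ennreal_mult max_def intro!: sum.cong)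
    also have "\<dots> = (\<integral>\<^sup>+t. (\<Sum>y\<in>S. ennreal (w y) * indicator {0..h y} t) \<partial>lborel)"
      by (simp add: nn_integral_sum nn_integral_cmult)
    also have "\<dots> \<le> (\<integral>\<^sup>+t. (\<integral>\<^sup>+s. indicator D (s, t) \<partial>\<mu>) + ennreal \<delta> * indicator {0..\<gamma>} t \<partial>lborel)"
    proof (intro nn_integral_mono)
      fix t :: real
      define F where "F = {y \<in> S. t \<le> h y}"
      show "(\<Sum>y\<in>S. ennreal (w y) * indicator {0..h y} t)
          \<le> (\<integral>\<^sup>+s. indicator D (s, t) \<partial>\<mu>) + ennreal \<delta> * indicator {0..\<gamma>} t"
      proof (cases "t \<in> {0..\<gamma>}")
        case True
        have "(\<Sum>y\<in>S. ennreal (w y) * indicator {0..h y} t) = (\<Sum>y\<in>F. ennreal (w y))"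
          unfolding F_def using True S by (intro sum.mono_neutral_cong_right) auto
        also have "\<dots> = ennreal (\<Sum>y\<in>F. w y)" using w by (intro sum_ennreal) (auto simp: F_def)
        also have "\<dots> \<le> ennreal (measure \<mu> (\<Union>y\<in>F. cball y \<delta>) + \<delta>)"
          by (intro ennreal_leI cover) (auto simp: F_def)
        also have "\<dots> = emeasure \<mu> (\<Union>y\<in>F. cball y \<delta>) + ennreal \<delta>"
          using \<delta> by (simp add: emeasure_eq_measure)
        also have "emeasure \<mu> (\<Union>y\<in>F. cball y \<delta>) = (\<integral>\<^sup>+s. indicator (\<Union>y\<in>F. cball y \<delta>) s \<partial>\<mu>)"
          using S by (subst nn_integral_indicator) (auto simp: F_def \<mu>(2) intro!: borel_closed closed_UN)
        also have "\<dots> = (\<integral>\<^sup>+s. indicator D (s, t) \<partial>\<mu>)"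
          using True by (intro nn_integral_cong) (auto simp: D_def F_def split: split_indicator)
        finally show ?thesis using True by simp
      next
        case False
        have "(\<Sum>y\<in>S. ennreal (w y) * indicator {0..h y} t) = 0"
        proof (intro sum.neutral ballI)
          fix y assume "y \<in> S"
          then have "h y \<le> \<gamma>" using M by (simp add: h_def)
          then show "ennreal (w y) * indicator {0..h y} t = 0" using False by auto
        qed
        then show ?thesis by simp
      qed
    qed
    also have "\<dots> = (\<integral>\<^sup>+t. (\<integral>\<^sup>+s. indicator D (s, t) \<partial>\<mu>) \<partial>lborel) + ennreal (\<gamma> * \<delta>)"
      using \<gamma> \<delta> by (subst nn_integral_add) (auto simp: nn_integral_cmult ennreal_mult mult.commute)
    finally have 1: "ennreal (\<Sum>y\<in>S. w y * max 0 (h y))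
      \<le> (\<integral>\<^sup>+t. (\<integral>\<^sup>+s. indicator D (s, t) \<partial>\<mu>) \<partial>lborel) + ennreal (\<gamma> * \<delta>)" .
    have "(\<integral>\<^sup>+t. (\<integral>\<^sup>+s. indicator D (s, t) \<partial>\<mu>) \<partial>lborel) = (\<integral>\<^sup>+s. (\<integral>\<^sup>+t. indicator D (s, t) \<partial>lborel) \<partial>\<mu>)"
      by (rule Fubini') measurable
    also have "\<dots> \<le> (\<integral>\<^sup>+s. ennreal (u s - M) \<partial>\<mu>)"
    proof (intro nn_integral_mono)
      fix s
      have "(\<integral>\<^sup>+t. indicator D (s, t) \<partial>lborel) \<le> (\<integral>\<^sup>+t. indicator {0..u s - M} t \<partial>lborel)"
      proof (intro nn_integral_mono)
        fix t :: real
        have "t \<in> {0..u s - M}" if "(s, t) \<in> D"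
        proof -
          obtain y where y: "y \<in> S" "dist y s \<le> \<delta>" "t \<le> h y" "0 \<le> t" using \<open>(s, t) \<in> D\<close> by (auto simp: D_def)
          then show ?thesis using feas[OF y(1), of s] by (simp add: h_def dist_commute)
        qed
        then show "(indicator D (s, t) :: ennreal) \<le> indicator {0..u s - M} t"
          by (auto split: split_indicator)
      qed
      then show "(\<integral>\<^sup>+t. indicator D (s, t) \<partial>lborel) \<le> ennreal (u s - M)" using uM[of s] by simp
    qed
    also have "\<dots> = ennreal (\<integral>s. (u s - M) \<partial>\<mu>)"
      using u uM by (intro nn_integral_eq_integral) auto
    finally have 2: "(\<integral>\<^sup>+t. (\<integral>\<^sup>+s. indicator D (s, t) \<partial>\<mu>) \<partial>lborel) \<le> ennreal (\<integral>s. (u s - M) \<partial>\<mu>)" .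
    have "0 \<le> (\<integral>s. (u s - M) \<partial>\<mu>)" using uM by (intro integral_nonneg_AE) simp
    then show ?thesis
      using order_trans[OF 1 add_right_mono[OF 2]] \<gamma> \<delta> by (subst ennreal_plus) auto
  qed
  then have "(\<Sum>y\<in>S. w y * max 0 (h y)) \<le> (\<integral>s. (u s - M) \<partial>\<mu>) + \<gamma> * \<delta>"
    using \<gamma> \<delta> uM by (subst (asm) ennreal_le_iff) (auto intro!: add_nonneg_nonneg integral_nonneg_AE)
  moreover have "(\<integral>s. (u s - M) \<partial>\<mu>) = (\<integral>s. u s \<partial>\<mu>) - M" using u by (simp add: prob_space)
  moreover have "(\<Sum>y\<in>S. w y * h y) = (\<Sum>y\<in>S. w y * v y) + \<gamma> - M"
  proof -
    have "(\<Sum>y\<in>S. w y * h y) = (\<Sum>y\<in>S. w y * v y + w y * (\<gamma> - M))"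
      by (intro sum.cong refl) (simp add: h_def algebra_simps)
    also have "\<dots> = (\<Sum>y\<in>S. w y * v y) + (\<Sum>y\<in>S. w y) * (\<gamma> - M)"
      by (simp only: sum.distrib sum_distrib_right)
    finally show ?thesis by (simp add: w(2))
  qed
  ultimately show ?thesis by (simp add: algebra_simps)
qed

section \<open>Weak duality\<close>

lemma scaled_exp_mono:
  assumes "0 \<le> \<beta>" "a \<le> b" shows "scaled_exp \<beta> a \<le> scaled_exp \<beta> b"
  using assms by (auto simp: scaled_exp_def divide_right_mono intro!: ennreal_leI mult_left_mono)

lemma measurable_scaled_exp[measurable]:
  assumes [measurable]: "f \<in> borel_measurable M"
  shows "(\<lambda>s. scaled_exp \<beta> (f s)) \<in> borel_measurable M"
  unfolding scaled_exp_def by measurable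

context observation_kernel
begin

text \<open>
  Let \<open>g\<close> be the density of \<open>\<upsilon>\<close> with respect to \<open>observed_law Obs Q\<close>. For \<open>\<beta> > 0\<close> the Fenchel--Young
  inequality gives \<open>g u \<le> \<beta> g ln g + \<beta> exp (u / \<beta> - 1)\<close>. For \<open>\<beta> = 0\<close> finiteness of the
  integrals means that \<open>u\<close> is nonpositive almost everywhere.
\<close>

lemma integral_le_rate_plus_scaled_exp:
  assumes \<upsilon>: "\<upsilon> \<in> space (prob_algebra borel)" and K: "rate Obs \<upsilon> Q = ereal K" and \<beta>: "0 \<le> \<beta>"
    and u[measurable]: "u \<in> borel_measurable borel" and C: "\<And>s. \<bar>u s\<bar> \<le> (C::real)"
    and fin: "\<And>\<xi>. (\<integral>\<^sup>+s. scaled_exp \<beta> (u s) \<partial>Obs \<xi>) < \<infinity>"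
  shows "(\<integral>s. u s \<partial>\<upsilon>) \<le> \<beta> * K + (\<Sum>\<xi>\<in>UNIV. pmf Q \<xi> * enn2real (\<integral>\<^sup>+s. scaled_exp \<beta> (u s) \<partial>Obs \<xi>))"
proof -
  let ?q = "observed_law Obs Q"
  interpret q: prob_space ?q by (rule prob_space_observed_law)
  interpret V: prob_space \<upsilon> using \<upsilon> by (simp add: space_prob_algebra)
  have sV: "sets \<upsilon> = sets ?q" using \<upsilon> by (simp add: space_prob_algebra)
  obtain g :: "'b \<Rightarrow> real" where g: "g \<in> borel_measurable ?q" "\<And>s. 0 \<le> g s" "\<upsilon> = density ?q g"
    "integrable ?q (\<lambda>s. g s * ln (g s))" "KL \<upsilon> ?q = ereal (\<integral>s. g s * ln (g s) \<partial>?q)"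
    using KL_finiteE[OF q.prob_space_axioms V.prob_space_axioms sV] K by (auto simp: rate_def)
  have Kg: "K = (\<integral>s. g s * ln (g s) \<partial>?q)" using g(5) K by (simp add: rate_def)
  have [measurable]: "g \<in> borel_measurable borel" using g(1) by simp
  show ?thesis
  proof (cases "\<beta> = 0")
    case False
    then have \<beta>: "0 < \<beta>" using \<beta> by simp
    define e where "e s = \<beta> * exp (u s / \<beta> - 1)" for s
    have [measurable]: "e \<in> borel_measurable borel" unfolding e_def by measurable
    have enn: "0 \<le> e s" for s using \<beta> by (simp add: e_def)
    have ei: "integrable ?q e"
    proof (rule q.integrable_const_bound[where B = "\<beta> * exp (C / \<beta> - 1)"])
      have "e s \<le> \<beta> * exp (C / \<beta> - 1)" for s
        unfolding e_def using \<beta> C[of s]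
        by (intro mult_left_mono) (auto intro!: divide_right_mono simp: abs_le_iff)
      then show "AE s in ?q. norm (e s) \<le> \<beta> * exp (C / \<beta> - 1)" using enn by simp
    qed measurable
    have gi: "integrable ?q g"
    proof (rule integrableI_nonneg)
      have "(\<integral>\<^sup>+s. ennreal (g s) \<partial>?q) = emeasure \<upsilon> UNIV"
        unfolding g(3) by (subst emeasure_density) auto
      then show "(\<integral>\<^sup>+s. ennreal (g s) \<partial>?q) < \<infinity>" by (simp add: V.emeasure_eq_measure)
    qed (auto simp: g(2))
    have gu: "integrable ?q (\<lambda>s. g s * u s)"
    proof (rule Bochner_Integration.integrable_bound[of _ "\<lambda>s. C * g s"])
      show "AE s in ?q. norm (g s * u s) \<le> norm (C * g s)"
      proof (intro AE_I2)
        fix s show "norm (g s * u s) \<le> norm (C * g s)"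
          using mult_right_mono[OF C[of s] g(2)[of s]] C[of s] g(2)[of s]
          by (simp add: abs_mult mult.commute)
      qed
    qed (use gi in auto)
    have "(\<integral>s. u s \<partial>\<upsilon>) = (\<integral>s. g s * u s \<partial>?q)"
      unfolding g(3) using g(2) by (subst integral_real_density) auto
    also have "\<dots> \<le> (\<integral>s. \<beta> * (g s * ln (g s)) + e s \<partial>?q)"
    proof (intro integral_mono)
      fix s
      have "g s * (u s / \<beta> - 1) - 1 * (exp (u s / \<beta> - 1) - 1) \<le> rel_ent (g s) 1"
        using g(2) by (intro rel_ent_ge_tangent) auto
      then have "g s * u s / \<beta> \<le> g s * ln (g s) + exp (u s / \<beta> - 1)"
        by (simp add: rel_ent_def algebra_simps)
      then have "\<beta> * (g s * u s / \<beta>) \<le> \<beta> * (g s * ln (g s) + exp (u s / \<beta> - 1))"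
        using \<beta> by (intro mult_left_mono) auto
      then show "g s * u s \<le> \<beta> * (g s * ln (g s)) + e s"
        using \<beta> by (simp add: e_def algebra_simps)
    qed (use gu g(4) ei in auto)
    also have "\<dots> = \<beta> * K + (\<integral>s. e s \<partial>?q)" using g(4) ei Kg by simp
    also have "(\<integral>s. e s \<partial>?q) = (\<Sum>\<xi>\<in>UNIV. pmf Q \<xi> * (\<integral>s. e s \<partial>Obs \<xi>))"
      using integral_observed_law(2)[OF ei] by simp
    finally have 1: "(\<integral>s. u s \<partial>\<upsilon>) \<le> \<beta> * K + (\<Sum>\<xi>\<in>UNIV. pmf Q \<xi> * (\<integral>s. e s \<partial>Obs \<xi>))"
      by simp
    have "(\<integral>s. e s \<partial>Obs \<xi>) = enn2real (\<integral>\<^sup>+s. scaled_exp \<beta> (u s) \<partial>Obs \<xi>)" for \<xi>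
    proof -
      have "(\<integral>s. e s \<partial>Obs \<xi>) = enn2real (\<integral>\<^sup>+s. ennreal (e s) \<partial>Obs \<xi>)"
        using enn by (intro integral_eq_nn_integral) auto
      moreover have "scaled_exp \<beta> (u s) = ennreal (e s)" for s
        using \<beta> by (simp add: scaled_exp_def e_def)
      ultimately show ?thesis by simp
    qed
    with 1 show ?thesis by simp
  next
    case True
    have "AE s in Obs \<xi>. u s \<le> 0" for \<xi>
    proof -
      have "AE s in Obs \<xi>. scaled_exp \<beta> (u s) \<noteq> \<infinity>"
        using fin[of \<xi>] by (intro nn_integral_PInf_AE) auto
      then show ?thesis by eventually_elim (auto simp: True scaled_exp_def split: if_splits)
    qed
    then have z: "emeasure (Obs \<xi>) {s. 0 < u s} = 0" for \<xi>
      by (subst (asm) AE_iff_measurable[where N = "{s. 0 < u s}"]) (auto simp: not_le)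
    have "emeasure ?q {s. 0 < u s} = (\<integral>\<^sup>+s. indicator {s. 0 < u s} s \<partial>?q)" by simp
    also have "\<dots> = 0" by (subst nn_integral_observed_law) (auto simp: z)
    finally have "AE s in ?q. u s \<le> 0"
      by (subst AE_iff_measurable[where N = "{s. 0 < u s}"]) (auto simp: not_le)
    then have "AE s in \<upsilon>. u s \<le> 0" unfolding g(3) by (subst AE_density) auto
    then have "(\<integral>s. u s \<partial>\<upsilon>) \<le> (\<integral>s. 0 \<partial>\<upsilon>)"
      using C sV order_trans[OF abs_ge_zero C] by (intro integral_mono_AE V.integrable_const_bound[where B = C])
        (auto simp: measurable_cong_sets[OF sV refl])
    also have "\<dots> \<le> \<beta> * K + (\<Sum>\<xi>\<in>UNIV. pmf Q \<xi> * enn2real (\<integral>\<^sup>+s. scaled_exp \<beta> (u s) \<partial>Obs \<xi>))"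
      by (simp add: True sum_nonneg)
    finally show ?thesis .
  qed
qed

text \<open>
  Weak duality. The infimum in \<open>smoothed_rate\<close> is approached up to an arbitrary \<open>e' > 0\<close> by some \<open>\<upsilon>\<close>,
  for which the integral of \<open>u\<close> is bounded from below by the transport part of the dual and from above by
  its divergence part. Replacing \<open>u\<close> by \<open>min u (M + \<gamma>)\<close> keeps it feasible, does not
  increase the objective, and makes it bounded and thus integrable.
\<close>

lemma expectation_le_dual_objective:
  assumes N: "1 \<le> N" and \<delta>: "0 \<le> \<delta>"
    and Q: "smoothed_rate Obs \<delta> (empirical N x) Q \<le> ereal r"
    and \<beta>: "0 \<le> \<beta>" and u[measurable]: "u \<in> borel_measurable borel" and \<gamma>: "0 \<le> \<gamma>"
    and feas: "\<And>s y. y \<in> supp (empirical N x) \<Longrightarrow> \<gamma> * of_bool (dist s y \<le> \<delta>) + v y \<le> u s"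
  shows "ereal (measure_pmf.expectation Q l) \<le>
    ereal (\<beta> * r - (LINT s:supp (empirical N x)|empirical N x. v s) + \<gamma> * (\<delta> - 1)) +
       (MAX \<xi>. ereal (l \<xi>) + enn2ereal (\<integral>\<^sup>+ s. scaled_exp \<beta> (u s) \<partial>Obs \<xi>))"
proof -
  define S where "S = supp (empirical N x)"
  define w where "w y = measure (empirical N x) {y}" for y
  define J where "J \<xi> = (\<integral>\<^sup>+ s. scaled_exp \<beta> (u s) \<partial>Obs \<xi>)" for \<xi>
  define m where "m = (MAX \<xi>. ereal (l \<xi>) + enn2ereal (J \<xi>))"
  have S: "finite S" "S \<noteq> {}"
    unfolding S_def using finite_supp_empirical[OF N] supp_empirical_nonempty[OF N] .
  have mle: "ereal (l \<xi>) + enn2ereal (J \<xi>) \<le> m" for \<xi> unfolding m_def by (intro Max_ge) auto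
  have I: "(LINT s:supp (empirical N x)|empirical N x. v s) = (\<Sum>y\<in>S. w y * v y)"
    unfolding S_def w_def by (rule set_integral_empirical_supp[OF N])
  have "ereal (measure_pmf.expectation Q l) \<le> ereal (\<beta> * r - (\<Sum>y\<in>S. w y * v y) + \<gamma> * (\<delta> - 1)) + m"
  proof (cases "m = \<infinity>")
    case True then show ?thesis by simp
  next
    case False
    have J: "J \<xi> < \<infinity>" for \<xi> using mle[of \<xi>] False by (cases "J \<xi>") (auto simp: top_ereal_def)
    have Jr: "ereal (l \<xi>) + enn2ereal (J \<xi>) = ereal (l \<xi> + enn2real (J \<xi>))" for \<xi>
      using J[of \<xi>] by (cases "J \<xi>") auto
    obtain m' where m: "m = ereal m'" using False mle[of undefined] Jr[of undefined] by (cases m) auto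
    have lJ: "l \<xi> + enn2real (J \<xi>) \<le> m'" for \<xi> using mle[of \<xi>] unfolding Jr m by simp
    define M where "M = Max (v ` S)"
    have M: "\<And>y. y \<in> S \<Longrightarrow> v y \<le> M" using S by (simp add: M_def)
    have "M \<in> v ` S" unfolding M_def using S by (intro Max_in) auto
    then obtain y0 where y0: "y0 \<in> S" "M = v y0" by auto
    have uM: "M \<le> u s" for s
    proof -
      have "0 \<le> \<gamma> * of_bool (dist s y0 \<le> \<delta>)" using \<gamma> by simp
      then show ?thesis using feas[of y0 s] y0 by (simp add: S_def)
    qed
    define u' where "u' s = min (u s) (M + \<gamma>)" for s
    have [measurable]: "u' \<in> borel_measurable borel" unfolding u'_def by measurable
    have feas': "\<gamma> * of_bool (dist s y \<le> \<delta>) + v y \<le> u' s" if "y \<in> S" for s y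
      using feas[of y s] M[OF that] \<gamma> that by (auto simp: u'_def S_def)
    have C: "\<bar>u' s\<bar> \<le> \<bar>M\<bar> + \<gamma>" for s using uM[of s] \<gamma> by (auto simp: u'_def)
    have J'J: "(\<integral>\<^sup>+ s. scaled_exp \<beta> (u' s) \<partial>Obs \<xi>) \<le> J \<xi>" for \<xi>
      unfolding J_def using \<beta> by (intro nn_integral_mono scaled_exp_mono) (auto simp: u'_def)
    have J': "(\<integral>\<^sup>+ s. scaled_exp \<beta> (u' s) \<partial>Obs \<xi>) < \<infinity>" for \<xi>
      using J'J[of \<xi>] J[of \<xi>] by (rule le_less_trans)
    have "measure_pmf.expectation Q l + (\<Sum>y\<in>S. w y * v y) + \<gamma> * (1 - \<delta>) - m' \<le> \<beta> * r + e" if "0 < e" for e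
    proof -
      \<comment> \<open>the rate enters the bound multiplied by \<open>\<beta>\<close>, so an excess of \<open>e'\<close> costs at most \<open>e\<close>\<close>
      define e' where "e' = e / (\<beta> + 1)"
      have e': "0 < e'" "\<beta> * e' \<le> e"
        using that \<beta> by (simp_all add: e'_def pos_divide_le_eq mult_right_mono)
      have "smoothed_rate Obs \<delta> (empirical N x) Q < ereal (r + e')"
        using Q by (rule le_less_trans) (use e' in simp)
      then obtain \<upsilon> where \<upsilon>: "\<upsilon> \<in> space (prob_algebra borel)"
        "levy_prokhorov \<upsilon> (empirical N x) \<le> \<delta>" "rate Obs \<upsilon> Q < ereal (r + e')"
        unfolding smoothed_rate_def INF_less_iff by auto
      have "rate Obs \<upsilon> Q \<noteq> - \<infinity>" unfolding rate_def KL_def by simp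
      then obtain K where K: "rate Obs \<upsilon> Q = ereal K" "K \<le> r + e'"
        using \<upsilon>(3) by (cases "rate Obs \<upsilon> Q") auto
      have pV: "prob_space \<upsilon>" and sV: "sets \<upsilon> = sets borel" using \<upsilon>(1) by (auto simp: space_prob_algebra)
      have u'i: "integrable \<upsilon> u'"
        using C by (intro finite_measure.integrable_const_bound[where B = "\<bar>M\<bar> + \<gamma>"])
          (auto simp: measurable_cong_sets[OF sV refl] prob_space.finite_measure pV)
      have "(\<Sum>y\<in>S. w y * v y) + \<gamma> * (1 - \<delta>) \<le> (\<integral>s. u' s \<partial>\<upsilon>)"
      proof (rule transport_dual_le[OF pV sV S])
        show "(\<Sum>y\<in>S. w y) = 1" unfolding S_def w_def by (rule sum_weights_empirical[OF N])
        fix F assume F: "F \<subseteq> S"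
        show "(\<Sum>y\<in>F. w y) \<le> measure \<upsilon> (\<Union>y\<in>F. cball y \<delta>) + \<delta>"
        proof -
          have "measure (empirical N x) F \<le> measure \<upsilon> (\<Union>y\<in>F. cball y \<delta>) + \<delta>"
            using \<upsilon>(2) F unfolding levy_prokhorov_empirical_le_iff_finite[OF N \<upsilon>(1) \<delta>] S_def by blast
          then show ?thesis
            unfolding w_def measure_empirical_subset_supp[OF N F[unfolded S_def]] .
        qed
      next
        show "0 \<le> w y" if "y \<in> S" for y by (simp add: w_def)
        show "\<gamma> * of_bool (dist s y \<le> \<delta>) + v y \<le> u' s" if "y \<in> S" for s y by (rule feas'[OF that])
      qed (fact \<delta> \<gamma> u'i)+
      also have "\<dots> \<le> \<beta> * K + (\<Sum>\<xi>\<in>UNIV. pmf Q \<xi> * enn2real (\<integral>\<^sup>+s. scaled_exp \<beta> (u' s) \<partial>Obs \<xi>))"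
        by (rule integral_le_rate_plus_scaled_exp[OF \<upsilon>(1) K(1) \<beta> _ C J']) measurable
      also have "\<dots> \<le> (\<beta> * r + e) + (\<Sum>\<xi>\<in>UNIV. pmf Q \<xi> * enn2real (J \<xi>))"
      proof (intro add_mono sum_mono mult_left_mono)
        have "\<beta> * K \<le> \<beta> * (r + e')" using K(2) \<beta> by (rule mult_left_mono)
        then show "\<beta> * K \<le> \<beta> * r + e" using e'(2) by (simp add: algebra_simps)
        show "enn2real (\<integral>\<^sup>+s. scaled_exp \<beta> (u' s) \<partial>Obs \<xi>) \<le> enn2real (J \<xi>)" for \<xi>
          using J'J[of \<xi>] J[of \<xi>] by (intro enn2real_mono) auto
      qed simp
      finally have 1: "(\<Sum>y\<in>S. w y * v y) + \<gamma> * (1 - \<delta>) \<le> (\<beta> * r + e) + (\<Sum>\<xi>\<in>UNIV. pmf Q \<xi> * enn2real (J \<xi>))" .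
      have "measure_pmf.expectation Q l + (\<Sum>\<xi>\<in>UNIV. pmf Q \<xi> * enn2real (J \<xi>))
          = (\<Sum>\<xi>\<in>UNIV. pmf Q \<xi> * (l \<xi> + enn2real (J \<xi>)))"
        by (subst integral_measure_pmf[of UNIV]) (auto simp: sum.distrib algebra_simps)
      also have "\<dots> \<le> (\<Sum>\<xi>\<in>UNIV. pmf Q \<xi> * m')" by (intro sum_mono mult_left_mono lJ) auto
      also have "\<dots> = m'" by (simp add: sum_distrib_right[symmetric] sum_pmf_eq_1)
      finally show ?thesis using 1 by simp
    qed
    then have "measure_pmf.expectation Q l + (\<Sum>y\<in>S. w y * v y) + \<gamma> * (1 - \<delta>) - m' \<le> \<beta> * r"
      by (rule field_le_epsilon)
    then show ?thesis unfolding m by (simp add: algebra_simps)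
  qed
  then show ?thesis unfolding m_def J_def I .
qed

end

section \<open>The convex form of the primal problem\<close>

lemma pmf_mixtureE:
  assumes "0 \<le> c" "c \<le> 1"
  obtains Q where "\<And>\<xi>. pmf Q \<xi> = c * pmf Q\<^sub>1 \<xi> + (1 - c) * pmf Q\<^sub>2 \<xi>"
proof
  show "pmf (bernoulli_pmf c \<bind> (\<lambda>i. if i then Q\<^sub>1 else Q\<^sub>2)) \<xi> = c * pmf Q\<^sub>1 \<xi> + (1 - c) * pmf Q\<^sub>2 \<xi>" for \<xi>
    using assms by (simp add: pmf_bind mult.commute)
qed

lemma expectation_pmf_finite:
  fixes l :: "'a::finite \<Rightarrow> real"
  shows "measure_pmf.expectation Q l = (\<Sum>\<xi>\<in>UNIV. pmf Q \<xi> * l \<xi>)"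
  by (subst integral_measure_pmf[of UNIV]) auto

context observation_kernel
begin

text \<open>
  The primal problem in a form where it is convex. A point consists of \<open>Q\<close> and of the densities
  \<open>\<rho> \<xi>\<close> of the parts, with respect to \<open>Obs \<xi>\<close>, of a measure on observations. The reference measures
  \<open>Obs \<xi>\<close> are fixed, so that such points can be mixed even though \<open>observed_law Obs Q\<close> varies with \<open>Q\<close>.
  The total mass is left free, as it gets its own multiplier.
\<close>

definition admissible :: "('a pmf \<times> ('a \<Rightarrow> 'b \<Rightarrow> real)) set" where
  "admissible = {(Q, \<rho>). (\<forall>\<xi>. \<rho> \<xi> \<in> borel_measurable borel) \<and> (\<forall>\<xi> s. 0 \<le> \<rho> \<xi> s) \<and>
     (\<forall>\<xi> s. pmf Q \<xi> = 0 \<longrightarrow> \<rho> \<xi> s = 0) \<and> (\<forall>\<xi>. integrable (Obs \<xi>) (\<rho> \<xi>)) \<and>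
     (\<forall>\<xi>. integrable (Obs \<xi>) (\<lambda>s. rel_ent (\<rho> \<xi> s) (pmf Q \<xi>)))}"

definition mass :: "('a \<Rightarrow> 'b \<Rightarrow> real) \<Rightarrow> 'b set \<Rightarrow> real" where
  "mass \<rho> B = (\<Sum>\<xi>\<in>UNIV. \<integral>s. \<rho> \<xi> s * indicator B s \<partial>Obs \<xi>)"

definition cost :: "'a pmf \<Rightarrow> ('a \<Rightarrow> 'b \<Rightarrow> real) \<Rightarrow> real" where
  "cost Q \<rho> = (\<Sum>\<xi>\<in>UNIV. \<integral>s. rel_ent (\<rho> \<xi> s) (pmf Q \<xi>) \<partial>Obs \<xi>)"

lemma admissibleD:
  assumes "(Q, \<rho>) \<in> admissible"
  shows "\<rho> \<xi> \<in> borel_measurable borel" "0 \<le> \<rho> \<xi> s" "pmf Q \<xi> = 0 \<Longrightarrow> \<rho> \<xi> s = 0"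
    "integrable (Obs \<xi>) (\<rho> \<xi>)" "integrable (Obs \<xi>) (\<lambda>s. rel_ent (\<rho> \<xi> s) (pmf Q \<xi>))"
  using assms by (auto simp: admissible_def)

lemma admissible_mix:
  assumes 1: "(Q\<^sub>1, \<rho>\<^sub>1) \<in> admissible" and 2: "(Q\<^sub>2, \<rho>\<^sub>2) \<in> admissible" and c: "0 < c" "c < 1"
  obtains Q \<rho> where "(Q, \<rho>) \<in> admissible" "cost Q \<rho> \<le> c * cost Q\<^sub>1 \<rho>\<^sub>1 + (1 - c) * cost Q\<^sub>2 \<rho>\<^sub>2"
    "\<And>B. B \<in> sets borel \<Longrightarrow> mass \<rho> B = c * mass \<rho>\<^sub>1 B + (1 - c) * mass \<rho>\<^sub>2 B"
    "\<And>l. measure_pmf.expectation Q l =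
      c * measure_pmf.expectation Q\<^sub>1 l + (1 - c) * measure_pmf.expectation Q\<^sub>2 (l :: 'a \<Rightarrow> real)"
proof -
  note D1 = admissibleD[OF 1] and D2 = admissibleD[OF 2]
  note [measurable] = D1(1) D2(1)
  obtain Q where Q: "\<And>\<xi>. pmf Q \<xi> = c * pmf Q\<^sub>1 \<xi> + (1 - c) * pmf Q\<^sub>2 \<xi>"
    using pmf_mixtureE[of c] c by (metis less_imp_le)
  define \<rho> where "\<rho> \<xi> s = c * \<rho>\<^sub>1 \<xi> s + (1 - c) * \<rho>\<^sub>2 \<xi> s" for \<xi> s
  have z: "pmf Q\<^sub>1 \<xi> = 0 \<and> pmf Q\<^sub>2 \<xi> = 0" if "pmf Q \<xi> = 0" for \<xi>
  proof -
    have "0 \<le> c * pmf Q\<^sub>1 \<xi>" "0 \<le> (1 - c) * pmf Q\<^sub>2 \<xi>" using c by auto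
    then have "c * pmf Q\<^sub>1 \<xi> = 0" "(1 - c) * pmf Q\<^sub>2 \<xi> = 0" using that Q[of \<xi>] by linarith+
    then show ?thesis using c by auto
  qed
  have m[measurable]: "\<rho> \<xi> \<in> borel_measurable borel" for \<xi> unfolding \<rho>_def by measurable
  have nn: "0 \<le> \<rho> \<xi> s" for \<xi> s unfolding \<rho>_def using c D1(2) D2(2) by simp
  have z\<rho>: "\<rho> \<xi> s = 0" if "pmf Q \<xi> = 0" for \<xi> s
    using z[OF that] D1(3) D2(3) by (simp add: \<rho>_def)
  have le: "rel_ent (\<rho> \<xi> s) (pmf Q \<xi>)
      \<le> c * rel_ent (\<rho>\<^sub>1 \<xi> s) (pmf Q\<^sub>1 \<xi>) + (1 - c) * rel_ent (\<rho>\<^sub>2 \<xi> s) (pmf Q\<^sub>2 \<xi>)" for \<xi> s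
    unfolding \<rho>_def Q using c D1(2,3) D2(2,3) by (intro rel_ent_convex) auto
  have i: "integrable (Obs \<xi>) (\<lambda>s. c * rel_ent (\<rho>\<^sub>1 \<xi> s) (pmf Q\<^sub>1 \<xi>)
      + (1 - c) * rel_ent (\<rho>\<^sub>2 \<xi> s) (pmf Q\<^sub>2 \<xi>))" for \<xi>
    using D1(5) D2(5) by (intro Bochner_Integration.integrable_add integrable_mult_right) auto
  have ri: "integrable (Obs \<xi>) (\<lambda>s. rel_ent (\<rho> \<xi> s) (pmf Q \<xi>))" for \<xi>
  proof (rule Bochner_Integration.integrable_bound[OF i])
    have "norm (rel_ent (\<rho> \<xi> s) (pmf Q \<xi>)) \<le> norm (c * rel_ent (\<rho>\<^sub>1 \<xi> s) (pmf Q\<^sub>1 \<xi>)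
      + (1 - c) * rel_ent (\<rho>\<^sub>2 \<xi> s) (pmf Q\<^sub>2 \<xi>))" for s
      using le[of \<xi> s] rel_ent_nonneg[OF nn[of \<xi> s] pmf_nonneg[of Q \<xi>]] z\<rho>[of \<xi> s] by simp
    then show "AE s in Obs \<xi>. norm (rel_ent (\<rho> \<xi> s) (pmf Q \<xi>)) \<le> norm (c * rel_ent (\<rho>\<^sub>1 \<xi> s) (pmf Q\<^sub>1 \<xi>)
      + (1 - c) * rel_ent (\<rho>\<^sub>2 \<xi> s) (pmf Q\<^sub>2 \<xi>))" by simp
  qed measurable
  show ?thesis
  proof
    have "integrable (Obs \<xi>) (\<rho> \<xi>)" for \<xi>
      unfolding \<rho>_def using D1(4) D2(4) by (intro Bochner_Integration.integrable_add integrable_mult_right) auto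
    then show "(Q, \<rho>) \<in> admissible" unfolding admissible_def using m nn z\<rho> ri by auto
    have "cost Q \<rho> \<le> (\<Sum>\<xi>\<in>UNIV. \<integral>s. c * rel_ent (\<rho>\<^sub>1 \<xi> s) (pmf Q\<^sub>1 \<xi>)
      + (1 - c) * rel_ent (\<rho>\<^sub>2 \<xi> s) (pmf Q\<^sub>2 \<xi>) \<partial>Obs \<xi>)"
      unfolding cost_def by (intro sum_mono integral_mono ri i le)
    also have "\<dots> = c * cost Q\<^sub>1 \<rho>\<^sub>1 + (1 - c) * cost Q\<^sub>2 \<rho>\<^sub>2"
      unfolding cost_def sum_distrib_left sum.distrib[symmetric]
      using D1(5) D2(5) by (intro sum.cong refl) (subst Bochner_Integration.integral_add, auto)
    finally show "cost Q \<rho> \<le> c * cost Q\<^sub>1 \<rho>\<^sub>1 + (1 - c) * cost Q\<^sub>2 \<rho>\<^sub>2" .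
    show "mass \<rho> B = c * mass \<rho>\<^sub>1 B + (1 - c) * mass \<rho>\<^sub>2 B" if [measurable]: "B \<in> sets borel" for B
    proof -
      have i: "integrable (Obs \<xi>) (\<lambda>s. \<rho>\<^sub>1 \<xi> s * indicator B s)"
        "integrable (Obs \<xi>) (\<lambda>s. \<rho>\<^sub>2 \<xi> s * indicator B s)" for \<xi>
        using D1(4) D2(4) by (auto intro!: integrable_real_mult_indicator)
      have "(\<integral>s. \<rho> \<xi> s * indicator B s \<partial>Obs \<xi>) = c * (\<integral>s. \<rho>\<^sub>1 \<xi> s * indicator B s \<partial>Obs \<xi>)
          + (1 - c) * (\<integral>s. \<rho>\<^sub>2 \<xi> s * indicator B s \<partial>Obs \<xi>)" for \<xi>
      proof -
        have "(\<integral>s. \<rho> \<xi> s * indicator B s \<partial>Obs \<xi>) =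
          (\<integral>s. c * (\<rho>\<^sub>1 \<xi> s * indicator B s) + (1 - c) * (\<rho>\<^sub>2 \<xi> s * indicator B s) \<partial>Obs \<xi>)"
          by (intro Bochner_Integration.integral_cong refl) (simp add: \<rho>_def algebra_simps)
        also have "\<dots> = c * (\<integral>s. \<rho>\<^sub>1 \<xi> s * indicator B s \<partial>Obs \<xi>)
          + (1 - c) * (\<integral>s. \<rho>\<^sub>2 \<xi> s * indicator B s \<partial>Obs \<xi>)"
          using i[of \<xi>] by (subst Bochner_Integration.integral_add) auto
        finally show ?thesis .
      qed
      then show ?thesis by (simp only: mass_def sum.distrib sum_distrib_left)
    qed
    show "measure_pmf.expectation Q l =
      c * measure_pmf.expectation Q\<^sub>1 l + (1 - c) * measure_pmf.expectation Q\<^sub>2 l" for l :: "'a \<Rightarrow> real"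
      by (simp add: expectation_pmf_finite Q sum_distrib_left algebra_simps flip: sum.distrib)
  qed
qed

text \<open>
  Splitting a density with respect to \<open>observed_law Obs Q\<close> proportionally to \<open>Q\<close> loses nothing:
  the cost is then the divergence of the marginals.
\<close>

lemma admissible_of_density:
  fixes g :: "'b \<Rightarrow> real"
  assumes [measurable]: "g \<in> borel_measurable borel" and nn: "\<And>s. 0 \<le> g s"
    and int: "integrable (observed_law Obs Q) g"
    and ent: "integrable (observed_law Obs Q) (\<lambda>s. rel_ent (g s) 1)"
  shows "(Q, \<lambda>\<xi> s. pmf Q \<xi> * g s) \<in> admissible"
    and "cost Q (\<lambda>\<xi> s. pmf Q \<xi> * g s) = (\<integral>s. rel_ent (g s) 1 \<partial>observed_law Obs Q)"
    and "\<And>B. B \<in> sets borel \<Longrightarrow>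
      mass (\<lambda>\<xi> s. pmf Q \<xi> * g s) B = (\<integral>s. g s * indicator B s \<partial>observed_law Obs Q)"
proof -
  have r: "rel_ent (pmf Q \<xi> * g s) (pmf Q \<xi>) = pmf Q \<xi> * rel_ent (g s) 1" for \<xi> s
    using rel_ent_mult[of "pmf Q \<xi>" "g s" 1] by simp
  show "(Q, \<lambda>\<xi> s. pmf Q \<xi> * g s) \<in> admissible"
    unfolding admissible_def using nn integral_observed_law(1)[OF int] integral_observed_law(1)[OF ent]
    by (auto simp: r)
  show "cost Q (\<lambda>\<xi> s. pmf Q \<xi> * g s) = (\<integral>s. rel_ent (g s) 1 \<partial>observed_law Obs Q)"
    unfolding cost_def r using integral_observed_law(2)[OF ent] by simp
  show "mass (\<lambda>\<xi> s. pmf Q \<xi> * g s) B = (\<integral>s. g s * indicator B s \<partial>observed_law Obs Q)"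
    if [measurable]: "B \<in> sets borel" for B
  proof -
    have "integrable (observed_law Obs Q) (\<lambda>s. g s * indicator B s)"
      using int by (intro integrable_real_mult_indicator) auto
    from integral_observed_law(2)[OF this] show ?thesis unfolding mass_def by (simp add: mult.assoc)
  qed
qed

lemma admissible_return:
  fixes h :: "'b \<Rightarrow> real"
  assumes [measurable]: "h \<in> borel_measurable borel" and nn: "\<And>s. 0 \<le> h s"
    and int: "integrable (Obs \<xi>) h" and ent: "integrable (Obs \<xi>) (\<lambda>s. rel_ent (h s) 1)"
  shows "(return_pmf \<xi>, \<lambda>\<eta> s. if \<eta> = \<xi> then h s else 0) \<in> admissible"
    and "cost (return_pmf \<xi>) (\<lambda>\<eta> s. if \<eta> = \<xi> then h s else 0) = (\<integral>s. rel_ent (h s) 1 \<partial>Obs \<xi>)"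
    and "mass (\<lambda>\<eta> s. if \<eta> = \<xi> then h s else 0) B = (\<integral>s. h s * indicator B s \<partial>Obs \<xi>)"
proof -
  have r: "rel_ent (if \<eta> = \<xi> then h s else 0) (pmf (return_pmf \<xi>) \<eta>) = (if \<eta> = \<xi> then rel_ent (h s) 1 else 0)"
    for \<eta> s by (simp add: rel_ent_def indicator_def)
  show "(return_pmf \<xi>, \<lambda>\<eta> s. if \<eta> = \<xi> then h s else 0) \<in> admissible"
    unfolding admissible_def
  proof (intro CollectI case_prodI conjI allI impI)
    fix \<eta> :: 'a and s :: 'b
    show "(\<lambda>s. if \<eta> = \<xi> then h s else 0) \<in> borel_measurable borel" by measurable
    show "0 \<le> (if \<eta> = \<xi> then h s else 0)" using nn by simp
    show "(if \<eta> = \<xi> then h s else 0) = 0" if "pmf (return_pmf \<xi>) \<eta> = 0"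
      using that by (auto simp: indicator_def split: if_splits)
    show "integrable (Obs \<eta>) (\<lambda>s. if \<eta> = \<xi> then h s else 0)"
      using int by (cases "\<eta> = \<xi>") auto
    show "integrable (Obs \<eta>) (\<lambda>s. rel_ent (if \<eta> = \<xi> then h s else 0) (pmf (return_pmf \<xi>) \<eta>))"
      unfolding r using ent by (cases "\<eta> = \<xi>") auto
  qed
  have 1: "(\<integral>s. rel_ent (if \<eta> = \<xi> then h s else 0) (pmf (return_pmf \<xi>) \<eta>) \<partial>Obs \<eta>)
    = (if \<eta> = \<xi> then \<integral>s. rel_ent (h s) 1 \<partial>Obs \<xi> else 0)" for \<eta>
    unfolding r by simp
  show "cost (return_pmf \<xi>) (\<lambda>\<eta> s. if \<eta> = \<xi> then h s else 0) = (\<integral>s. rel_ent (h s) 1 \<partial>Obs \<xi>)"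
    unfolding cost_def 1 by simp
  have 2: "(\<integral>s. (if \<eta> = \<xi> then h s else 0) * indicator B s \<partial>Obs \<eta>)
    = (if \<eta> = \<xi> then \<integral>s. h s * indicator B s \<partial>Obs \<xi> else 0)" for \<eta> by simp
  show "mass (\<lambda>\<eta> s. if \<eta> = \<xi> then h s else 0) B = (\<integral>s. h s * indicator B s \<partial>Obs \<xi>)"
    unfolding mass_def 2 by simp
qed

lemma smoothed_rate_le_of_admissible:
  assumes N: "1 \<le> N" and \<delta>: "0 \<le> \<delta>" and adm: "(Q, \<rho>) \<in> admissible"
    and "cost Q \<rho> \<le> r" "mass \<rho> UNIV = 1"
    and F: "\<And>F. F \<subseteq> supp (empirical N x) \<Longrightarrow>
      measure (empirical N x) F \<le> mass \<rho> (\<Union>y\<in>F. cball y \<delta>) + \<delta>"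
  shows "smoothed_rate Obs \<delta> (empirical N x) Q \<le> ereal r"
proof -
  note D = admissibleD[OF adm]
  obtain p where p: "p \<in> space (prob_algebra borel)"
    "\<And>B. B \<in> sets borel \<Longrightarrow> measure p B = mass \<rho> B" "rate Obs p Q \<le> ereal (cost Q \<rho>)"
    using rate_mixture_le[of \<rho> Q, OF D] assms(5) unfolding mass_def cost_def by auto
  have "levy_prokhorov p (empirical N x) \<le> \<delta>"
    unfolding levy_prokhorov_empirical_le_iff_finite[OF N p(1) \<delta>]
  proof (intro allI impI)
    fix F assume "F \<subseteq> supp (empirical N x)"
    moreover from this have "finite F" using finite_supp_empirical[OF N] finite_subset by blast
    then have "(\<Union>y\<in>F. cball y \<delta>) \<in> sets borel" by (intro borel_closed closed_UN) auto
    ultimately show "measure (empirical N x) F \<le> measure p (\<Union>y\<in>F. cball y \<delta>) + \<delta>"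
      using F p(2) by simp
  qed
  then show ?thesis
    unfolding smoothed_rate_def using p(1,3) assms(4)
    by (intro INF_lower2[of p]) (auto intro: order_trans)
qed

text \<open>
  Since the distance is strictly below \<open>\<delta>\<close>, the constraints hold already with some \<open>d < \<delta>\<close>
  and hence strictly with \<open>\<delta>\<close>.
\<close>

lemma slater_admissibleE:
  assumes N: "1 \<le> N" and \<delta>: "0 < \<delta>"
    and Ps: "Ps \<in> space (prob_algebra borel)" "rate Obs Ps Q < ereal r"
      "levy_prokhorov Ps (empirical N x) < \<delta>"
  obtains \<rho> where "(Q, \<rho>) \<in> admissible" "cost Q \<rho> < r" "mass \<rho> UNIV = 1"
    "\<And>F. F \<subseteq> supp (empirical N x) \<Longrightarrow>
      measure (empirical N x) F < mass \<rho> (\<Union>y\<in>F. cball y \<delta>) + \<delta>"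
proof -
  let ?q = "observed_law Obs Q"
  interpret q: prob_space ?q by (rule prob_space_observed_law)
  interpret V: prob_space Ps using Ps(1) by (simp add: space_prob_algebra)
  have sV: "sets Ps = sets ?q" using Ps(1) by (simp add: space_prob_algebra)
  have spV: "space Ps = UNIV" using sets_eq_imp_space_eq[OF sV] by simp
  have "rate Obs Ps Q < \<infinity>" using Ps(2) by (auto intro: less_trans)
  then obtain g :: "'b \<Rightarrow> real" where g: "g \<in> borel_measurable ?q" "\<And>s. 0 \<le> g s" "Ps = density ?q g"
    "integrable ?q (\<lambda>s. g s * ln (g s))" "KL Ps ?q = ereal (\<integral>s. g s * ln (g s) \<partial>?q)"
    using KL_finiteE[OF q.prob_space_axioms V.prob_space_axioms sV] unfolding rate_def by blast
  have gm[measurable]: "g \<in> borel_measurable borel" using g(1) by simp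
  have em: "emeasure Ps B = (\<integral>\<^sup>+s. ennreal (g s * indicator B s) \<partial>?q)" if [measurable]: "B \<in> sets borel" for B
    unfolding g(3) by (subst emeasure_density) (auto intro!: nn_integral_cong split: split_indicator)
  have gi: "integrable ?q g"
  proof (rule integrableI_nonneg)
    have "(\<integral>\<^sup>+s. ennreal (g s) \<partial>?q) = ennreal (measure Ps UNIV)"
      using em[of UNIV] by (simp add: V.emeasure_eq_measure)
    then show "(\<integral>\<^sup>+s. ennreal (g s) \<partial>?q) < \<infinity>" by simp
  qed (auto simp: g(2))
  have ms: "(\<integral>s. g s * indicator B s \<partial>?q) = measure Ps B" if [measurable]: "B \<in> sets borel" for B
  proof -
    have "integrable ?q (\<lambda>s. g s * indicator B s)" using gi by (intro integrable_real_mult_indicator) auto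
    then have "emeasure Ps B = ennreal (\<integral>s. g s * indicator B s \<partial>?q)"
      unfolding em[OF that] using g(2) by (intro nn_integral_eq_integral) auto
    then show ?thesis using g(2) by (simp add: measure_def integral_nonneg_AE)
  qed
  have g1: "(\<integral>s. g s \<partial>?q) = 1" using ms[of UNIV] V.prob_space spV by simp
  have ri: "integrable ?q (\<lambda>s. rel_ent (g s) 1)"
    unfolding rel_ent_def using gi g(4) by auto
  have "(\<integral>s. rel_ent (g s) 1 \<partial>?q) = (\<integral>s. g s * ln (g s) \<partial>?q)"
    unfolding rel_ent_def using gi g(4) g1 q.prob_space by simp
  then have cost: "(\<integral>s. rel_ent (g s) 1 \<partial>?q) < r" using g(5) Ps(2) by (simp add: rate_def)
  note adm = admissible_of_density[OF gm g(2) gi ri]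
  show ?thesis
  proof (rule that[OF adm(1)])
    show "cost Q (\<lambda>\<xi> s. pmf Q \<xi> * g s) < r" using adm(2) cost by simp
    show "mass (\<lambda>\<xi> s. pmf Q \<xi> * g s) UNIV = 1" using adm(3)[of UNIV] g1 by simp
    fix F assume F: "F \<subseteq> supp (empirical N x)"
    have fin: "finite F" using F finite_supp_empirical[OF N] finite_subset by blast
    have E[measurable]: "(\<Union>y\<in>F. cball y d) \<in> sets borel" for d
      using fin by (intro borel_closed closed_UN) auto
    define d where "d = max 0 (levy_prokhorov Ps (empirical N x))"
    have d: "0 \<le> d" "d < \<delta>" "levy_prokhorov Ps (empirical N x) \<le> d" using \<delta> Ps(3) by (auto simp: d_def)
    have "measure (empirical N x) F \<le> measure Ps (\<Union>y\<in>F. cball y d) + d"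
      using d(3) F unfolding levy_prokhorov_empirical_le_iff_finite[OF N Ps(1) d(1)] by blast
    also have "measure Ps (\<Union>y\<in>F. cball y d) \<le> measure Ps (\<Union>y\<in>F. cball y \<delta>)"
      using E[of \<delta>] d(2) sV by (intro V.finite_measure_mono UN_mono subset_cball) auto
    also have "\<dots> = mass (\<lambda>\<xi> s. pmf Q \<xi> * g s) (\<Union>y\<in>F. cball y \<delta>)" using adm(3) ms by simp
    finally show "measure (empirical N x) F < mass (\<lambda>\<xi> s. pmf Q \<xi> * g s) (\<Union>y\<in>F. cball y \<delta>) + \<delta>"
      using d(2) by simp
  qed
qed

end

section \<open>Strong duality\<close>

context observation_kernel
begin

text \<open>
  The divergence bound is indexed by \<open>None\<close> and the Levy--Prokhorov constraint of a set
  \<open>F\<close> by \<open>Some F\<close>. They are priced among the points of total mass \<open>1\<close>, where the Slater point lives; the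
  normalisation is priced afterwards, between the measures \<open>0\<close> and \<open>2 * observed_law Obs Qs\<close>.
\<close>

lemma strong_duality_multipliers:
  fixes l :: "'a \<Rightarrow> real"
  assumes N: "1 \<le> N" and \<delta>: "0 < \<delta>"
    and slater: "Ps \<in> space (prob_algebra borel)" "rate Obs Ps Qs < ereal r"
      "levy_prokhorov Ps (empirical N x) < \<delta>"
    and V: "\<And>Q. smoothed_rate Obs \<delta> (empirical N x) Q \<le> ereal r \<Longrightarrow> measure_pmf.expectation Q l \<le> V"
  shows "\<exists>\<beta> t. \<exists>c :: 'b set \<Rightarrow> real. 0 \<le> \<beta> \<and> (\<forall>F\<subseteq>supp (empirical N x). 0 \<le> c F) \<and>
    (\<forall>(Q, \<rho>)\<in>admissible. measure_pmf.expectation Q l \<le> V + \<beta> * (cost Q \<rho> - r)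
      + (\<Sum>F\<in>Pow (supp (empirical N x)). c F * (measure (empirical N x) F - \<delta> - mass \<rho> (\<Union>y\<in>F. cball y \<delta>)))
      + t * (mass \<rho> UNIV - 1))"
proof -
  let ?P = "empirical N x"
  define S where "S = supp ?P"
  have S: "finite S" unfolding S_def by (rule finite_supp_empirical[OF N])
  define E where "E F = (\<Union>y\<in>F. cball y \<delta>)" for F :: "'b set"
  have Es: "E F \<in> sets borel" if "F \<subseteq> S" for F
    unfolding E_def using finite_subset[OF that S] by (intro borel_closed closed_UN) auto
  define f where "f = (\<lambda>(Q, \<rho> :: 'a \<Rightarrow> 'b \<Rightarrow> real). measure_pmf.expectation Q l)"
  define G where "G j = (\<lambda>(Q, \<rho>). case j of None \<Rightarrow> cost Q \<rho> - r
      | Some F \<Rightarrow> measure ?P F - \<delta> - mass \<rho> (E F))" for j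
  define J where "J = insert None (Some ` Pow S)"
  have J: "finite J" using S by (simp add: J_def)
  have sumJ: "(\<Sum>j\<in>J. k j * G j p) = k None * G None p + (\<Sum>F\<in>Pow S. k (Some F) * G (Some F) p)" for k p
    unfolding J_def using S by (subst sum.insert) (auto simp: sum.reindex)
  define X where "X = {(Q, \<rho>). (Q, \<rho>) \<in> admissible \<and> mass \<rho> UNIV = 1}"
  have mix: "\<exists>w\<in>admissible. f w = d * f p + (1 - d) * f q
      \<and> mass (snd w) UNIV = d * mass (snd p) UNIV + (1 - d) * mass (snd q) UNIV
      \<and> (\<forall>j\<in>J. G j w \<le> d * G j p + (1 - d) * G j q)"
    if pq: "p \<in> admissible" "q \<in> admissible" and d: "0 < d" "d < 1" for p q d
  proof -
    obtain Q1 \<rho>1 where p: "p = (Q1, \<rho>1)" by (cases p)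
    obtain Q2 \<rho>2 where q: "q = (Q2, \<rho>2)" by (cases q)
    obtain Q \<rho> where w: "(Q, \<rho>) \<in> admissible" "cost Q \<rho> \<le> d * cost Q1 \<rho>1 + (1 - d) * cost Q2 \<rho>2"
      "\<And>B. B \<in> sets borel \<Longrightarrow> mass \<rho> B = d * mass \<rho>1 B + (1 - d) * mass \<rho>2 B"
      "\<And>l. measure_pmf.expectation Q l =
        d * measure_pmf.expectation Q1 l + (1 - d) * measure_pmf.expectation Q2 (l :: 'a \<Rightarrow> real)"
      using admissible_mix[of Q1 \<rho>1 Q2 \<rho>2 d] pq d unfolding p q by blast
    have "G j (Q, \<rho>) \<le> d * G j p + (1 - d) * G j q" if "j \<in> J" for j
    proof (cases j)
      case None then show ?thesis using w(2) by (simp add: G_def p q algebra_simps)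
    next
      case (Some F)
      then have "F \<subseteq> S" using that by (auto simp: J_def)
      from w(3)[OF Es[OF this]] show ?thesis using Some by (simp add: G_def p q algebra_simps)
    qed
    then show ?thesis using w by (intro bexI[of _ "(Q, \<rho>)"]) (auto simp: f_def p q)
  qed
  have cv: "concavelike X f J G"
    unfolding concavelike_def
  proof (intro ballI)
    fix p q d assume pq: "p \<in> X" "q \<in> X" and d: "d \<in> {0<..<1::real}"
    have adm: "p \<in> admissible" "q \<in> admissible" and m: "mass (snd p) UNIV = 1" "mass (snd q) UNIV = 1"
      using pq by (auto simp: X_def)
    obtain w where w: "w \<in> admissible" "f w = d * f p + (1 - d) * f q"
      "mass (snd w) UNIV = d * mass (snd p) UNIV + (1 - d) * mass (snd q) UNIV"
      "\<forall>j\<in>J. G j w \<le> d * G j p + (1 - d) * G j q"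
      using mix[OF adm, of d] d by auto
    have "w \<in> X" using w(1,3) m by (auto simp: X_def)
    then show "\<exists>w\<in>X. d * f p + (1 - d) * f q \<le> f w \<and> (\<forall>j\<in>J. G j w \<le> d * G j p + (1 - d) * G j q)"
      using w(2,4) by (intro bexI[of _ w]) simp_all
  qed
  obtain \<rho>s where \<rho>s: "(Qs, \<rho>s) \<in> admissible" "cost Qs \<rho>s < r" "mass \<rho>s UNIV = 1"
    "\<And>F. F \<subseteq> S \<Longrightarrow> measure ?P F < mass \<rho>s (E F) + \<delta>"
    using slater_admissibleE[OF N \<delta> slater] unfolding S_def E_def by blast
  have s: "(Qs, \<rho>s) \<in> X" "\<And>j. j \<in> J \<Longrightarrow> G j (Qs, \<rho>s) < 0"
    using \<rho>s by (auto simp: X_def J_def G_def algebra_simps)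
  have fV: "f p \<le> V" if p: "p \<in> X" and G: "\<And>j. j \<in> J \<Longrightarrow> G j p \<le> 0" for p
  proof -
    obtain Q \<rho> where p': "p = (Q, \<rho>)" by (cases p)
    have "smoothed_rate Obs \<delta> ?P Q \<le> ereal r"
    proof (rule smoothed_rate_le_of_admissible[OF N])
      show "(Q, \<rho>) \<in> admissible" "mass \<rho> UNIV = 1" using p by (auto simp: X_def p')
      show "cost Q \<rho> \<le> r" using G[of None] by (simp add: J_def G_def p')
      show "measure ?P F \<le> mass \<rho> (\<Union>y\<in>F. cball y \<delta>) + \<delta>" if "F \<subseteq> supp ?P" for F
        using G[of "Some F"] that by (simp add: J_def G_def p' S_def E_def)
    qed (use \<delta> in simp)
    then show ?thesis using V by (simp add: f_def p')
  qed
  obtain k where k: "\<And>j. j \<in> J \<Longrightarrow> 0 \<le> k j" "\<And>p. p \<in> X \<Longrightarrow> f p \<le> V + (\<Sum>j\<in>J. k j * G j p)"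
    using multipliers_inequalities[OF J cv s fV] by blast
  define f' where "f' p = f p - (\<Sum>j\<in>J. k j * G j p)" for p
  define e where "e p = mass (snd p) UNIV - 1" for p :: "'a pmf \<times> ('a \<Rightarrow> 'b \<Rightarrow> real)"
  have const: "(Qs, \<lambda>\<xi> s. pmf Qs \<xi> * a) \<in> admissible"
    "e (Qs, \<lambda>\<xi> s. pmf Qs \<xi> * a) = a - 1" if "0 \<le> a" for a
  proof -
    interpret q: prob_space "observed_law Obs Qs" by (rule prob_space_observed_law)
    have "(\<lambda>_::'b. a) \<in> borel_measurable borel" "integrable (observed_law Obs Qs) (\<lambda>_. a)"
      "integrable (observed_law Obs Qs) (\<lambda>s. rel_ent a 1)" by auto
    note adm = admissible_of_density[OF this(1) that this(2,3)]
    from adm(1) show "(Qs, \<lambda>\<xi> s. pmf Qs \<xi> * a) \<in> admissible" .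
    show "e (Qs, \<lambda>\<xi> s. pmf Qs \<xi> * a) = a - 1"
      using adm(3)[of UNIV] q.prob_space by (simp add: e_def)
  qed
  obtain t where t: "\<And>p. p \<in> admissible \<Longrightarrow> f' p \<le> V + t * e p"
  proof (rule multiplier_equality[of admissible f' e])
    fix p q d assume pq: "p \<in> admissible" "q \<in> admissible" and d: "0 < d" "d < (1::real)"
    obtain w where w: "w \<in> admissible" "f w = d * f p + (1 - d) * f q"
      "mass (snd w) UNIV = d * mass (snd p) UNIV + (1 - d) * mass (snd q) UNIV"
      "\<forall>j\<in>J. G j w \<le> d * G j p + (1 - d) * G j q"
      using mix[OF pq d] by auto
    have "(\<Sum>j\<in>J. k j * G j w) \<le> (\<Sum>j\<in>J. k j * (d * G j p + (1 - d) * G j q))"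
      using w(4) k(1) by (intro sum_mono mult_left_mono) auto
    also have "\<dots> = d * (\<Sum>j\<in>J. k j * G j p) + (1 - d) * (\<Sum>j\<in>J. k j * G j q)"
      unfolding sum_distrib_left sum.distrib[symmetric] by (intro sum.cong refl) (simp add: algebra_simps)
    finally have "d * f' p + (1 - d) * f' q \<le> f' w" using w(2) by (simp add: f'_def algebra_simps)
    moreover have "e w = d * e p + (1 - d) * e q" using w(3) by (simp add: e_def algebra_simps)
    ultimately show "\<exists>w\<in>admissible. d * f' p + (1 - d) * f' q \<le> f' w \<and> e w = d * e p + (1 - d) * e q"
      using w(1) by auto
  next
    show "(Qs, \<lambda>\<xi> s. pmf Qs \<xi> * 0) \<in> admissible" "e (Qs, \<lambda>\<xi> s. pmf Qs \<xi> * 0) < 0" using const[of 0] by auto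
    show "(Qs, \<lambda>\<xi> s. pmf Qs \<xi> * 2) \<in> admissible" "0 < e (Qs, \<lambda>\<xi> s. pmf Qs \<xi> * 2)" using const[of 2] by auto
    fix p assume "p \<in> admissible" "e p = 0"
    then have "p \<in> X" by (auto simp: X_def e_def)
    then show "f' p \<le> V" using k(2)[of p] by (simp add: f'_def)
  qed blast
  have "f p \<le> V + k None * (cost (fst p) (snd p) - r) + (\<Sum>F\<in>Pow S. k (Some F) *
      (measure ?P F - \<delta> - mass (snd p) (E F))) + t * (mass (snd p) UNIV - 1)" if "p \<in> admissible" for p
    using t[OF that] unfolding f'_def sumJ by (simp add: G_def e_def split_beta)
  moreover have "0 \<le> k None" "\<forall>F\<subseteq>S. 0 \<le> k (Some F)" using k(1) by (simp_all add: J_def)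
  ultimately show ?thesis
    unfolding S_def[symmetric] E_def[symmetric]
    by (intro exI[of _ "k None"] exI[of _ t] exI[of _ "\<lambda>F. k (Some F)"]) (auto simp: f_def)
qed

text \<open>
  The supremum over \<open>h\<close> of the Lagrangian on the left of \<open>bound\<close> is the integral of
  \<open>scaled_exp \<beta> u\<close>. For \<open>\<beta> > 0\<close> it is attained at \<open>h = exp (u / \<beta> - 1)\<close>. For \<open>\<beta> = 0\<close>
  the Lagrangian is linear in \<open>h\<close>, and large multiples of the indicator of \<open>u > 0\<close> show that this
  set is null.
\<close>

lemma scaled_exp_integral_le:
  fixes u :: "'b \<Rightarrow> real"
  assumes u[measurable]: "u \<in> borel_measurable borel" and C: "\<And>s. \<bar>u s\<bar> \<le> C" and \<beta>: "0 \<le> \<beta>"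
    and bound: "\<And>h. h \<in> borel_measurable borel \<Longrightarrow> (\<And>s. 0 \<le> h s) \<Longrightarrow> integrable (Obs \<xi>) h \<Longrightarrow>
      integrable (Obs \<xi>) (\<lambda>s. rel_ent (h s) 1) \<Longrightarrow>
      (\<integral>s. h s * (u s - \<beta>) \<partial>Obs \<xi>) - \<beta> * (\<integral>s. rel_ent (h s) 1 \<partial>Obs \<xi>) + \<beta> \<le> K"
  shows "enn2ereal (\<integral>\<^sup>+s. scaled_exp \<beta> (u s) \<partial>Obs \<xi>) \<le> ereal K"
proof -
  interpret prob_space "Obs \<xi>" by (rule prob_space_Obs)
  have p1: "measure (Obs \<xi>) UNIV = 1" using prob_space by simp
  have bi: "integrable (Obs \<xi>) f" if "f \<in> borel_measurable borel" "\<And>s. \<bar>f s\<bar> \<le> B" for f :: "'b \<Rightarrow> real" and B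
    using that by (intro integrable_const_bound[where B = B]) auto
  show ?thesis
  proof (cases "\<beta> = 0")
    case False
    then have b: "0 < \<beta>" using \<beta> by simp
    define h where "h s = exp (u s / \<beta> - 1)" for s
    have h[measurable]: "h \<in> borel_measurable borel" unfolding h_def by measurable
    have hnn: "0 \<le> h s" for s by (simp add: h_def)
    have hi: "integrable (Obs \<xi>) h"
    proof (rule bi[OF h])
      fix s
      have "u s / \<beta> \<le> C / \<beta>" using C[of s] b by (intro divide_right_mono) (auto simp: abs_le_iff)
      then show "\<bar>h s\<bar> \<le> exp (C / \<beta> - 1)" by (simp add: h_def)
    qed
    have re: "rel_ent (h s) 1 = h s * (u s / \<beta> - 1) - h s + 1" for s
      by (simp add: rel_ent_def h_def)
    have hu: "integrable (Obs \<xi>) (\<lambda>s. h s * u s)"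
    proof (rule Bochner_Integration.integrable_bound[of _ "\<lambda>s. C * h s"])
      show "AE s in Obs \<xi>. norm (h s * u s) \<le> norm (C * h s)"
      proof (intro AE_I2)
        fix s show "norm (h s * u s) \<le> norm (C * h s)"
          using mult_right_mono[OF C[of s] hnn[of s]] C[of s] hnn[of s]
          by (simp add: abs_mult mult.commute)
      qed
    qed (use hi in auto)
    have 1: "integrable (Obs \<xi>) (\<lambda>s. h s * (u s - \<beta>))" using hu hi by (simp add: right_diff_distrib)
    have "h s * (u s / \<beta> - 1) = (h s * (u s - \<beta>)) / \<beta>" for s using b by (simp add: field_simps)
    then have 2: "integrable (Obs \<xi>) (\<lambda>s. rel_ent (h s) 1)" unfolding re using 1 hi by simp
    have "(\<integral>s. \<beta> * h s \<partial>Obs \<xi>) = (\<integral>s. h s * (u s - \<beta>) - \<beta> * rel_ent (h s) 1 + \<beta> \<partial>Obs \<xi>)"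
      using b by (intro Bochner_Integration.integral_cong refl) (simp add: re field_simps)
    also have "\<dots> = (\<integral>s. h s * (u s - \<beta>) \<partial>Obs \<xi>) - \<beta> * (\<integral>s. rel_ent (h s) 1 \<partial>Obs \<xi>) + \<beta>"
      using 1 2 p1 by simp
    also have "\<dots> \<le> K" using bound[OF h hnn hi 2] .
    finally have le: "(\<integral>s. \<beta> * h s \<partial>Obs \<xi>) \<le> K" .
    have "(\<integral>\<^sup>+s. scaled_exp \<beta> (u s) \<partial>Obs \<xi>) = (\<integral>\<^sup>+s. ennreal (\<beta> * h s) \<partial>Obs \<xi>)"
      using b by (simp add: scaled_exp_def h_def)
    also have "\<dots> = ennreal (\<integral>s. \<beta> * h s \<partial>Obs \<xi>)"
      using hi b hnn by (intro nn_integral_eq_integral) auto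
    finally show ?thesis
      using le b hnn by (simp add: enn2ereal_ennreal integral_nonneg_AE del: integral_mult_right_zero)
  next
    case True
    define a where "a = (\<integral>s. max 0 (u s) \<partial>Obs \<xi>)"
    have ai: "integrable (Obs \<xi>) (\<lambda>s. max 0 (u s))"
    proof (rule bi)
      show "\<bar>max 0 (u s)\<bar> \<le> C" for s using C[of s] by auto
    qed measurable
    have le: "\<sigma> * a \<le> K" if \<sigma>: "0 \<le> \<sigma>" for \<sigma>
    proof -
      define h where "h s = \<sigma> * indicator {s. 0 < u s} s" for s
      have h[measurable]: "h \<in> borel_measurable borel" unfolding h_def by measurable
      have hnn: "0 \<le> h s" for s using \<sigma> by (simp add: h_def)
      have hi: "integrable (Obs \<xi>) h"
        by (rule bi[OF h, of \<sigma>]) (use \<sigma> in \<open>auto simp: h_def indicator_def\<close>)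
      have ri: "integrable (Obs \<xi>) (\<lambda>s. rel_ent (h s) 1)"
      proof (rule bi)
        show "\<bar>rel_ent (h s) 1\<bar> \<le> \<bar>rel_ent \<sigma> 1\<bar> + \<bar>rel_ent 0 1\<bar>" for s
          by (auto simp: h_def indicator_def)
      qed measurable
      have "\<sigma> * a = (\<integral>s. h s * (u s - \<beta>) \<partial>Obs \<xi>)"
        unfolding a_def integral_mult_right_zero[symmetric]
        by (intro Bochner_Integration.integral_cong refl) (auto simp: h_def True indicator_def max_def)
      also have "\<dots> \<le> K" using bound[OF h hnn hi ri] by (simp add: True)
      finally show ?thesis .
    qed
    have K: "0 \<le> K" using le[of 0] by simp
    have "a = 0"
    proof (rule ccontr)
      assume "a \<noteq> 0"
      moreover have "0 \<le> a" unfolding a_def by (intro integral_nonneg_AE) auto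
      ultimately have "0 < a" by simp
      then show False using le[of "(K + 1) / a"] K by simp
    qed
    then have "AE s in Obs \<xi>. max 0 (u s) = 0"
      using ai unfolding a_def by (subst (asm) integral_nonneg_eq_0_iff_AE) auto
    then have "AE s in Obs \<xi>. scaled_exp \<beta> (u s) = 0"
      by eventually_elim (simp add: scaled_exp_def True max_def split: if_splits)
    then have "(\<integral>\<^sup>+s. scaled_exp \<beta> (u s) \<partial>Obs \<xi>) = 0"
      by (subst nn_integral_0_iff_AE) auto
    then show ?thesis using K by (simp add: zero_ennreal.rep_eq)
  qed
qed

text \<open>
  From the multipliers \<open>c F\<close> of the finitely many Levy--Prokhorov constraints, a dual solution is read off as
  \<open>\<gamma> = (\<Sum>F. c F)\<close>, \<open>v = (\<Sum>F. c F * (indicator F - 1)) - t'\<close> and \<open>u = (\<Sum>F. c F * indicator (E F)) - t'\<close>,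
  where \<open>E F\<close> is the closed enlargement of \<open>F\<close>. Feasibility can be checked for each \<open>F\<close> separately:
  if \<open>s\<close> is within \<open>\<delta>\<close> of \<open>y \<in> F\<close>, then \<open>s \<in> E F\<close>. Evaluating the Lagrangian at measures
  concentrated on one \<open>\<xi>\<close> bounds each term of the maximum.
\<close>

lemma dual_attainedE:
  fixes l :: "'a \<Rightarrow> real"
  assumes N: "1 \<le> N" and \<delta>: "0 < \<delta>"
    and slater: "Ps \<in> space (prob_algebra borel)" "rate Obs Ps Qs < ereal r"
      "levy_prokhorov Ps (empirical N x) < \<delta>"
    and V: "\<And>Q. smoothed_rate Obs \<delta> (empirical N x) Q \<le> ereal r \<Longrightarrow> measure_pmf.expectation Q l \<le> V"
  obtains \<beta> u v \<gamma> where "0 \<le> \<beta>" "u \<in> borel_measurable borel" "0 \<le> \<gamma>"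
    "\<And>s y. y \<in> supp (empirical N x) \<Longrightarrow> \<gamma> * of_bool (dist s y \<le> \<delta>) + v y \<le> u s"
    "ereal (\<beta> * r - (LINT s:supp (empirical N x)|empirical N x. v s) + \<gamma> * (\<delta> - 1)) +
       (MAX \<xi>. ereal (l \<xi>) + enn2ereal (\<integral>\<^sup>+ s. scaled_exp \<beta> (u s) \<partial>Obs \<xi>)) \<le> ereal V"
proof -
  let ?P = "empirical N x"
  define S where "S = supp ?P"
  have S: "finite S" unfolding S_def by (rule finite_supp_empirical[OF N])
  define E where "E F = (\<Union>y\<in>F. cball y \<delta>)" for F :: "'b set"
  have Es: "E F \<in> sets borel" if "F \<subseteq> S" for F
    unfolding E_def using finite_subset[OF that S] by (intro borel_closed closed_UN) auto
  have "\<exists>\<beta> t. \<exists>c :: 'b set \<Rightarrow> real. 0 \<le> \<beta> \<and> (\<forall>F\<subseteq>S. 0 \<le> c F) \<and>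
    (\<forall>(Q, \<rho>)\<in>admissible. measure_pmf.expectation Q l \<le> V + \<beta> * (cost Q \<rho> - r)
      + (\<Sum>F\<in>Pow S. c F * (measure ?P F - \<delta> - mass \<rho> (E F))) + t * (mass \<rho> UNIV - 1))"
    unfolding S_def E_def by (rule strong_duality_multipliers[OF N \<delta> slater]) (rule V)
  then obtain \<beta> t and c :: "'b set \<Rightarrow> real" where \<beta>: "0 \<le> \<beta>" and c': "\<forall>F\<subseteq>S. 0 \<le> c F"
    and L': "\<forall>(Q, \<rho>)\<in>admissible. measure_pmf.expectation Q l \<le> V + \<beta> * (cost Q \<rho> - r)
      + (\<Sum>F\<in>Pow S. c F * (measure ?P F - \<delta> - mass \<rho> (E F))) + t * (mass \<rho> UNIV - 1)"
    by (elim exE conjE)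
  have c: "0 \<le> c F" if "F \<subseteq> S" for F using c' that by blast
  have L: "measure_pmf.expectation Q l \<le> V + \<beta> * (cost Q \<rho> - r)
      + (\<Sum>F\<in>Pow S. c F * (measure ?P F - \<delta> - mass \<rho> (E F))) + t * (mass \<rho> UNIV - 1)"
    if "(Q, \<rho>) \<in> admissible" for Q \<rho> using bspec[OF L' that] by simp
  define w where "w y = measure ?P {y}" for y
  \<comment> \<open>the shift by \<open>\<beta>\<close> accounts for the terms \<open>- a + b\<close> in \<open>rel_ent\<close>\<close>
  define t' where "t' = t - \<beta>"
  define \<gamma> where "\<gamma> = (\<Sum>F\<in>Pow S. c F)"
  define v where "v y = (\<Sum>F\<in>Pow S. c F * (of_bool (y \<in> F) - 1)) - t'" for y
  define u where "u s = (\<Sum>F\<in>Pow S. c F * indicator (E F) s) - t'" for s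
  have u[measurable]: "u \<in> borel_measurable borel"
    unfolding u_def using Es
    by (intro borel_measurable_diff borel_measurable_sum borel_measurable_times borel_measurable_indicator)
      auto
  have \<gamma>: "0 \<le> \<gamma>" unfolding \<gamma>_def using c by (intro sum_nonneg) auto
  have feas: "\<gamma> * of_bool (dist s y \<le> \<delta>) + v y \<le> u s" if "y \<in> S" for s y
  proof -
    have "\<gamma> * of_bool (dist s y \<le> \<delta>) + v y
        = (\<Sum>F\<in>Pow S. c F * (of_bool (dist s y \<le> \<delta>) + of_bool (y \<in> F) - 1)) - t'"
      by (simp add: \<gamma>_def v_def sum_distrib_right algebra_simps flip: sum.distrib)
    also have "\<dots> \<le> (\<Sum>F\<in>Pow S. c F * indicator (E F) s) - t'"
      using c by (intro diff_right_mono sum_mono mult_left_mono)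
        (auto simp: E_def indicator_def dist_commute)
    finally show ?thesis by (simp add: u_def)
  qed
  have wF: "(\<Sum>y\<in>S. w y * of_bool (y \<in> F)) = measure ?P F" if "F \<subseteq> S" for F
  proof -
    have "(\<Sum>y\<in>S. w y * of_bool (y \<in> F)) = (\<Sum>y\<in>F. w y)"
      using that S by (intro sum.mono_neutral_cong_right) auto
    then show ?thesis using measure_empirical_subset_supp[OF N that[unfolded S_def]] by (simp add: w_def)
  qed
  have w1: "(\<Sum>y\<in>S. w y) = 1" unfolding w_def S_def by (rule sum_weights_empirical[OF N])
  have "(LINT s:S|?P. v s) = (\<Sum>y\<in>S. w y * v y)"
    unfolding S_def w_def by (rule set_integral_empirical_supp[OF N])
  also have "\<dots> = (\<Sum>y\<in>S. (\<Sum>F\<in>Pow S. c F * (w y * of_bool (y \<in> F) - w y)) - t' * w y)"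
    by (intro sum.cong refl) (simp add: v_def right_diff_distrib sum_distrib_left algebra_simps)
  also have "\<dots> = (\<Sum>F\<in>Pow S. \<Sum>y\<in>S. c F * (w y * of_bool (y \<in> F) - w y)) - t'"
  proof -
    have "(\<Sum>y\<in>S. t' * w y) = t'" by (simp add: w1 flip: sum_distrib_left)
    then show ?thesis by (subst sum_subtractf) (simp only: sum.swap[of _ S "Pow S"])
  qed
  also have "\<dots> = (\<Sum>F\<in>Pow S. c F * (measure ?P F - 1)) - t'"
    by (simp add: sum_distrib_left[symmetric] sum_subtractf wF w1)
  finally have v: "(LINT s:S|?P. v s) = (\<Sum>F\<in>Pow S. c F * (measure ?P F - 1)) - t'" .
  define A where "A = \<beta> * r - (LINT s:S|?P. v s) + \<gamma> * (\<delta> - 1)"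
  have A: "A = \<beta> * r + t' - (\<Sum>F\<in>Pow S. c F * (measure ?P F - \<delta>))"
    unfolding A_def v \<gamma>_def by (simp add: algebra_simps sum.distrib sum_subtractf sum_distrib_left)
  have C: "\<bar>u s\<bar> \<le> \<gamma> + \<bar>t'\<bar>" for s
  proof -
    have "0 \<le> (\<Sum>F\<in>Pow S. c F * indicator (E F) s)" using c by (intro sum_nonneg) auto
    moreover have "(\<Sum>F\<in>Pow S. c F * indicator (E F) s) \<le> \<gamma>"
      unfolding \<gamma>_def using c by (intro sum_mono) (auto simp: indicator_def)
    ultimately show ?thesis by (simp add: u_def)
  qed
  have le: "enn2ereal (\<integral>\<^sup>+s. scaled_exp \<beta> (u s) \<partial>Obs \<xi>) \<le> ereal (V - A - l \<xi>)" for \<xi>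
  proof (rule scaled_exp_integral_le[OF u C \<beta>])
    fix h :: "'b \<Rightarrow> real"
    assume h[measurable]: "h \<in> borel_measurable borel" and nn: "\<And>s. 0 \<le> h s"
      and int: "integrable (Obs \<xi>) h" and ent: "integrable (Obs \<xi>) (\<lambda>s. rel_ent (h s) 1)"
    define R where "R = (\<integral>s. rel_ent (h s) 1 \<partial>Obs \<xi>)"
    define m where "m B = (\<integral>s. h s * indicator B s \<partial>Obs \<xi>)" for B
    note adm = admissible_return[OF h nn int ent]
    have "l \<xi> \<le> V + \<beta> * (R - r) + (\<Sum>F\<in>Pow S. c F * (measure ?P F - \<delta> - m (E F))) + t * (m UNIV - 1)"
      using L[OF adm(1)] by (simp only: adm(2,3) expectation_return_pmf R_def m_def)
    moreover have "(\<integral>s. h s * (u s - \<beta>) \<partial>Obs \<xi>) = (\<Sum>F\<in>Pow S. c F * m (E F)) - t * m UNIV"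
    proof -
      have i: "integrable (Obs \<xi>) (\<lambda>s. c F * (h s * indicator (E F) s))" if "F \<in> Pow S" for F
        using int Es[of F] that by (intro integrable_mult_right integrable_real_mult_indicator) auto
      have "(\<integral>s. h s * (u s - \<beta>) \<partial>Obs \<xi>)
          = (\<integral>s. (\<Sum>F\<in>Pow S. c F * (h s * indicator (E F) s)) - t * h s \<partial>Obs \<xi>)"
        by (intro Bochner_Integration.integral_cong refl)
          (simp add: u_def t'_def right_diff_distrib sum_distrib_left algebra_simps)
      also have "\<dots> = (\<integral>s. (\<Sum>F\<in>Pow S. c F * (h s * indicator (E F) s)) \<partial>Obs \<xi>) - (\<integral>s. t * h s \<partial>Obs \<xi>)"
        using i int by (intro Bochner_Integration.integral_diff Bochner_Integration.integrable_sum) auto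
      also have "(\<integral>s. (\<Sum>F\<in>Pow S. c F * (h s * indicator (E F) s)) \<partial>Obs \<xi>)
          = (\<Sum>F\<in>Pow S. \<integral>s. c F * (h s * indicator (E F) s) \<partial>Obs \<xi>)"
        using i by (rule Bochner_Integration.integral_sum)
      finally show ?thesis by (simp add: m_def)
    qed
    moreover have "(\<Sum>F\<in>Pow S. c F * (measure ?P F - \<delta> - m (E F)))
        = (\<Sum>F\<in>Pow S. c F * (measure ?P F - \<delta>)) - (\<Sum>F\<in>Pow S. c F * m (E F))"
      by (simp add: right_diff_distrib sum_subtractf)
    ultimately show "(\<integral>s. h s * (u s - \<beta>) \<partial>Obs \<xi>) - \<beta> * (\<integral>s. rel_ent (h s) 1 \<partial>Obs \<xi>) + \<beta> \<le> V - A - l \<xi>"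
      unfolding R_def[symmetric] A t'_def by (simp add: algebra_simps)
  qed
  have "ereal (l \<xi>) + enn2ereal (\<integral>\<^sup>+s. scaled_exp \<beta> (u s) \<partial>Obs \<xi>) \<le> ereal (V - A)" for \<xi>
    using add_left_mono[OF le[of \<xi>], of "ereal (l \<xi>)"] by simp
  then have "(MAX \<xi>. ereal (l \<xi>) + enn2ereal (\<integral>\<^sup>+ s. scaled_exp \<beta> (u s) \<partial>Obs \<xi>)) \<le> ereal (V - A)"
    by (subst Max_le_iff) auto
  from add_left_mono[OF this, of "ereal A"]
  have "ereal A + (MAX \<xi>. ereal (l \<xi>) + enn2ereal (\<integral>\<^sup>+ s. scaled_exp \<beta> (u s) \<partial>Obs \<xi>)) \<le> ereal V"
    by simp
  with that[OF \<beta> u \<gamma>] feas show ?thesis unfolding A_def S_def by blast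
qed

end

theorem theorem3p3:
  fixes Obs :: "'a::finite \<Rightarrow> 'b::polish_space measure"
    and loss :: "'z \<Rightarrow> 'a \<Rightarrow> real"
    and x :: "nat \<Rightarrow> 'b"
    and N :: nat and \<delta> r :: real and z :: 'z
  assumes Obs: "Obs \<in> measurable (count_space UNIV) (prob_algebra borel)"
    and N: "1 \<le> N"
    and \<delta>: "0 < \<delta>"
    and r: "0 < r"
    and slater: "\<exists>Qs. \<exists>Ps \<in> space (prob_algebra borel).
      rate Obs Ps Qs < ereal r \<and> levy_prokhorov Ps (empirical N x) < \<delta>"
  shows "predictor loss Obs r \<delta> z (empirical N x) =
    (INF (\<beta>, u, v, \<gamma>) \<in> {(\<beta> :: real, u :: 'b \<Rightarrow> real, v :: 'b \<Rightarrow> real, \<gamma> :: real).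
         0 \<le> \<beta> \<and> u \<in> borel_measurable borel \<and> 0 \<le> \<gamma> \<and>
         (\<forall>\<xi>'. \<forall>\<xi>\<^sub>i \<in> supp (empirical N x). \<gamma> * of_bool (dist \<xi>' \<xi>\<^sub>i \<le> \<delta>) + v \<xi>\<^sub>i \<le> u \<xi>')}.
       ereal (\<beta> * r - (LINT \<xi>':supp (empirical N x)|empirical N x. v \<xi>') + \<gamma> * (\<delta> - 1)) +
       (MAX \<xi>. ereal (loss z \<xi>) + enn2ereal (\<integral>\<^sup>+ \<xi>'. scaled_exp \<beta> (u \<xi>') \<partial>Obs \<xi>)))"
proof -
  interpret observation_kernel Obs by unfold_locales (rule Obs)
  let ?P = "empirical N x" and ?l = "loss z"
  define c where "c = predictor loss Obs r \<delta> z ?P"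
  obtain Qs Ps where s: "Ps \<in> space (prob_algebra borel)" "rate Obs Ps Qs < ereal r"
    "levy_prokhorov Ps ?P < \<delta>" using slater by blast
  have upper: "ereal (measure_pmf.expectation Q ?l) \<le> c"
    if "smoothed_rate Obs \<delta> ?P Q \<le> ereal r" for Q
    unfolding c_def predictor_def using that by (intro SUP_upper) simp
  have "smoothed_rate Obs \<delta> ?P Qs \<le> ereal r"
    unfolding smoothed_rate_def using s by (intro INF_lower2[of Ps]) auto
  then have "ereal (measure_pmf.expectation Qs ?l) \<le> c" by (rule upper)
  moreover have "c \<le> ereal (Max (range ?l))"
    unfolding c_def predictor_def
  proof (intro SUP_least)
    fix Q
    have "measure_pmf.expectation Q ?l \<le> measure_pmf.expectation Q (\<lambda>_. Max (range ?l))"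
      by (intro integral_mono integrable_measure_pmf_finite) auto
    then show "ereal (measure_pmf.expectation Q ?l) \<le> ereal (Max (range ?l))" by simp
  qed
  ultimately obtain V where V: "c = ereal V" by (cases c) auto
  obtain \<beta> u v \<gamma> where d: "0 \<le> \<beta>" "u \<in> borel_measurable borel" "0 \<le> \<gamma>"
    "\<And>s y. y \<in> supp ?P \<Longrightarrow> \<gamma> * of_bool (dist s y \<le> \<delta>) + v y \<le> u s"
    "ereal (\<beta> * r - (LINT s:supp ?P|?P. v s) + \<gamma> * (\<delta> - 1)) +
       (MAX \<xi>. ereal (?l \<xi>) + enn2ereal (\<integral>\<^sup>+ s. scaled_exp \<beta> (u s) \<partial>Obs \<xi>)) \<le> ereal V"
  proof (rule dual_attainedE[OF N \<delta> s, of ?l V])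
    show "measure_pmf.expectation Q ?l \<le> V" if "smoothed_rate Obs \<delta> ?P Q \<le> ereal r" for Q
      using upper[OF that] by (simp add: V)
  qed blast
  show ?thesis
  proof (rule antisym)
    show "predictor loss Obs r \<delta> z ?P \<le> (INF (\<beta>, u, v, \<gamma>) \<in> {(\<beta>, u, v, \<gamma>).
         0 \<le> \<beta> \<and> u \<in> borel_measurable borel \<and> 0 \<le> \<gamma> \<and>
         (\<forall>\<xi>'. \<forall>\<xi>\<^sub>i \<in> supp ?P. \<gamma> * of_bool (dist \<xi>' \<xi>\<^sub>i \<le> \<delta>) + v \<xi>\<^sub>i \<le> u \<xi>')}.
       ereal (\<beta> * r - (LINT \<xi>':supp ?P|?P. v \<xi>') + \<gamma> * (\<delta> - 1)) +
       (MAX \<xi>. ereal (loss z \<xi>) + enn2ereal (\<integral>\<^sup>+ \<xi>'. scaled_exp \<beta> (u \<xi>') \<partial>Obs \<xi>)))"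
      unfolding predictor_def using \<delta>
      by (intro SUP_least INF_greatest) (auto intro!: expectation_le_dual_objective[OF N])
    show "(INF (\<beta>, u, v, \<gamma>) \<in> {(\<beta>, u, v, \<gamma>).
         0 \<le> \<beta> \<and> u \<in> borel_measurable borel \<and> 0 \<le> \<gamma> \<and>
         (\<forall>\<xi>'. \<forall>\<xi>\<^sub>i \<in> supp ?P. \<gamma> * of_bool (dist \<xi>' \<xi>\<^sub>i \<le> \<delta>) + v \<xi>\<^sub>i \<le> u \<xi>')}.
       ereal (\<beta> * r - (LINT \<xi>':supp ?P|?P. v \<xi>') + \<gamma> * (\<delta> - 1)) +
       (MAX \<xi>. ereal (loss z \<xi>) + enn2ereal (\<integral>\<^sup>+ \<xi>'. scaled_exp \<beta> (u \<xi>') \<partial>Obs \<xi>)))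
       \<le> predictor loss Obs r \<delta> z ?P"
      unfolding c_def[symmetric] V using d
      by (intro INF_lower2[of "(\<beta>, u, v, \<gamma>)"]) auto
  qed
qed

end
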